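(* If $T\ne K_1$ is a tree and if $\mathcal{F}$ is a family of graphs, then for every integer $k\ge 1$ either $$\mathrm{ex}(n,T,\mathcal{F})=\Omega_{T,k}(n^k),$$ or $$\mathrm{ex}(n,T,\mathcal{F})=O_{T,k,\mathcal{F}}\left(\mathrm{ex}(n,\mathcal{F})^{k-1}\right).$$
   Context: Graphs are finite and simple. A graph is $\mathcal{F}$-free, for a family of graphs $\mathcal{F}$, if it contains no (not necessarily induced) subgraph isomorphic to a member of $\mathcal{F}$. $\mathrm{ex}(n,\mathcal{F})$ is the maximum number of edges in an $n$-vertex $\mathcal{F}$-free graph, and $\mathrm{ex}(n,T,\mathcal{F})$ is the maximum number of copies of $T$ (subgraphs isomorphic to $T$) that an $n$-vertex $\mathcal{F}$-free graph can have; both are $0$ by convention if there is no $\mathcal{F}$-free graph on $n$ vertices. Asymptotics are as $n\to\infty$, and subscripts on $O,\Omega$ indicate what the implied constants may depend on. *)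

theory Defs
  imports Complex_Main "HOL-Library.Landau_Symbols"
begin

datatype 'a graph = Graph (verts: "'a set") (edges: "'a set set")

definition simple_graph :: "'a graph \<Rightarrow> bool" where
  "simple_graph G \<longleftrightarrow> finite (verts G) \<and> (\<forall>e\<in>edges G. e \<subseteq> verts G \<and> card e = 2)"

definition subgraph :: "'a graph \<Rightarrow> 'a graph \<Rightarrow> bool" where
  "subgraph H G \<longleftrightarrow> simple_graph H \<and> verts H \<subseteq> verts G \<and> edges H \<subseteq> edges G"

definition graph_iso :: "'a graph \<Rightarrow> 'b graph \<Rightarrow> bool" where
  "graph_iso G H \<longleftrightarrow> (\<exists>f. bij_betw f (verts G) (verts H) \<and> edges H = (\<lambda>e. f ` e) ` edges G)"

definition complete_graph :: "nat \<Rightarrow> nat graph" where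
  "complete_graph n = Graph {..<n} {e. e \<subseteq> {..<n} \<and> card e = 2}"

definition connected_graph :: "'a graph \<Rightarrow> bool" where
  "connected_graph G \<longleftrightarrow> verts G \<noteq> {} \<and>
     (\<forall>u\<in>verts G. \<forall>v\<in>verts G. (u, v) \<in> {(x, y). {x, y} \<in> edges G}\<^sup>*)"

definition is_cycle :: "'a graph \<Rightarrow> 'a list \<Rightarrow> bool" where
  "is_cycle G vs \<longleftrightarrow> length vs \<ge> 3 \<and> distinct vs \<and>
     (\<forall>i. Suc i < length vs \<longrightarrow> {vs ! i, vs ! Suc i} \<in> edges G) \<and> {last vs, hd vs} \<in> edges G"

definition tree :: "'a graph \<Rightarrow> bool" where
  "tree T \<longleftrightarrow> simple_graph T \<and> connected_graph T \<and> (\<nexists>vs. is_cycle T vs)"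

definition copies :: "'a graph \<Rightarrow> 'b graph \<Rightarrow> 'b graph set" where
  "copies T G = {H. subgraph H G \<and> graph_iso T H}"

definition free_of :: "'a graph set \<Rightarrow> 'b graph \<Rightarrow> bool" where
  "free_of \<F> G \<longleftrightarrow> (\<forall>H\<in>\<F>. copies H G = {})"

text \<open>
  All quantities below are invariant under isomorphism of the host graph, so the
  $n$-vertex graphs are represented by those with vertex set $\{0,\dots,n-1\}$; there are
  finitely many of these, so the maxima exist.
\<close>

definition free_graphs :: "nat \<Rightarrow> 'a graph set \<Rightarrow> nat graph set" where
  "free_graphs n \<F> = {G. simple_graph G \<and> verts G = {..<n} \<and> free_of \<F> G}"

definition ex :: "nat \<Rightarrow> 'a graph set \<Rightarrow> nat" where
  "ex n \<F> = (if free_graphs n \<F> = {} then 0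
     else Max ((\<lambda>G. card (edges G)) ` free_graphs n \<F>))"

definition gen_ex :: "nat \<Rightarrow> 'b graph \<Rightarrow> 'a graph set \<Rightarrow> nat" where
  "gen_ex n T \<F> = (if free_graphs n \<F> = {} then 0
     else Max ((\<lambda>G. card (copies T G)) ` free_graphs n \<F>))"

end

(* For U a union of k pairwise separated (disjoint and non-adjacent) nonempty vertex sets of T, clone U
   t times. If for some U all these blow-ups are F-free, choosing one clone per part independently
   gives t^k copies of T on at most t |V(T)| vertices. Otherwise F-free graphs contain no such
   t-fold blow-up for some fixed t. Fix an embedding phi of T and call a connected vertex set C
   flexible if C has many pairwise disjoint re-embeddings compatible with phi on the boundary of C.
   Flexible sets contain no k pairwise separated ones, since these could be glued to a blow-up; by
   min-max duality for subtrees of a tree, fewer than k edges of T meet all of them. There are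
   O(e(G)^(k-1)) possible values of phi on those edges, and each value is attained boundedly often:
   otherwise the sunflower lemma gives a sunflower of embeddings whose kernel contains these edges,
   and a component of the complement of the kernel is a flexible set missing all of them. *)

theory Submission
  imports Defs "HOL-Library.FuncSet"
begin

section \<open>Separated and connected vertex sets, embeddings, blow-ups\<close>

definition separated :: "'a graph \<Rightarrow> 'a set \<Rightarrow> 'a set \<Rightarrow> bool" where
  "separated T C D \<longleftrightarrow> C \<inter> D = {} \<and> (\<forall>c\<in>C. \<forall>d\<in>D. {c, d} \<notin> edges T)"

text \<open>Connectedness of the subgraph of \<open>T\<close> induced on \<open>D\<close>, stated
  through cuts instead of paths; deleting a leaf or splitting off a component then concerns single
  edges.\<close>

definition connected_set :: "'a graph \<Rightarrow> 'a set \<Rightarrow> bool" where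
  "connected_set T D \<longleftrightarrow> D \<noteq> {} \<and>
     (\<forall>A. A \<subset> D \<longrightarrow> A \<noteq> {} \<longrightarrow> (\<exists>a\<in>A. \<exists>b\<in>D - A. {a, b} \<in> edges T))"

text \<open>Extensional functions are taken so that an embedding is determined by its values on
  \<open>verts T\<close> and embeddings can be counted.\<close>

definition embeddings :: "'a graph \<Rightarrow> 'b graph \<Rightarrow> ('a \<Rightarrow> 'b) set" where
  "embeddings T G = {\<phi> \<in> verts T \<rightarrow>\<^sub>E verts G. inj_on \<phi> (verts T) \<and> (\<forall>e\<in>edges T. \<phi> ` e \<in> edges G)}"

text \<open>Vertices outside \<open>U\<close> only occur with index 0.\<close>

definition blowup :: "'a graph \<Rightarrow> 'a set \<Rightarrow> nat \<Rightarrow> ('a \<times> nat) graph" where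
  "blowup T U t = (let W = {(x, i). x \<in> verts T \<and> i < (if x \<in> U then t else 1)} in
     Graph W {{(x, i), (y, j)} | x i y j.
       (x, i) \<in> W \<and> (y, j) \<in> W \<and> {x, y} \<in> edges T \<and> (x \<in> U \<longrightarrow> y \<in> U \<longrightarrow> i = j)})"

lemma separated_sym: "separated T C D \<Longrightarrow> separated T D C"
  unfolding separated_def by (metis Int_commute insert_commute)

section \<open>Leaves of forests and min-max duality for subtrees\<close>

text \<open>The first vertex of a longest path inside \<open>W\<close> has all its neighbours in
  \<open>W\<close> on that path, and a neighbour beyond the second vertex would close a cycle. If
  there is no neighbour, \<open>p\<close> carries no information.\<close>

lemma acyclic_imp_leaf:
  assumes T: "simple_graph T" and acyc: "\<nexists>vs. is_cycle T vs"
    and W: "finite W" "W \<noteq> {}"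
  shows "\<exists>l\<in>W. \<exists>p. \<forall>q\<in>W. {l, q} \<in> edges T \<longrightarrow> q = p"
proof -
  define path where "path vs \<longleftrightarrow> vs \<noteq> [] \<and> distinct vs \<and> set vs \<subseteq> W \<and>
     (\<forall>i. Suc i < length vs \<longrightarrow> {vs ! i, vs ! Suc i} \<in> edges T)" for vs
  obtain w where "w \<in> W" using W by auto
  then have "path [w]" by (simp add: path_def)
  moreover have "length vs < Suc (card W)" if "path vs" for vs
    using that card_mono[OF W(1), of "set vs"] by (simp add: path_def distinct_card)
  ultimately obtain vs where vs: "path vs" and max: "\<And>us. path us \<Longrightarrow> length us \<le> length vs"
    by (metis ex_has_greatest_nat_lemma ex_has_greatest_nat)
  have "q = vs ! 1" if q: "q \<in> W" "{hd vs, q} \<in> edges T" for q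
  proof -
    have hd0: "hd vs = vs ! 0" using vs by (simp add: path_def hd_conv_nth)
    have "q \<in> set vs"
    proof (rule ccontr)
      assume "q \<notin> set vs"
      moreover have "{(q # vs) ! i, (q # vs) ! Suc i} \<in> edges T" if "Suc i < length (q # vs)" for i
        using that q vs hd0 by (cases i) (auto simp: path_def insert_commute)
      ultimately have "path (q # vs)" using vs q by (simp add: path_def)
      from max[OF this] show False by simp
    qed
    then obtain i where i: "i < length vs" "q = vs ! i" by (auto simp: in_set_conv_nth)
    have "i \<noteq> 0"
    proof
      assume "i = 0"
      then have "{q} \<in> edges T" using q i hd0 by simp
      then show False using T by (auto simp: simple_graph_def)
    qed
    moreover have "\<not> 2 \<le> i"
    proof
      assume "2 \<le> i"
      have len: "length (take (Suc i) vs) = Suc i" using i by simp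
      then have "last (take (Suc i) vs) = q" using i by (subst last_conv_nth) auto
      moreover have "hd (take (Suc i) vs) = hd vs" by simp
      ultimately have "is_cycle T (take (Suc i) vs)"
        using vs i q len \<open>2 \<le> i\<close> unfolding is_cycle_def path_def
        by (auto simp: insert_commute)
      then show False using acyc by blast
    qed
    ultimately have "i = 1" by simp
    then show ?thesis using i by simp
  qed
  then show ?thesis using vs by (intro bexI[of _ "hd vs"]) (auto simp: path_def)
qed

text \<open>Induction by removing a leaf of the forest induced on \<open>W\<close>; the leaf
  condition is assumed for all nonempty subsets so that it survives the removal. Edges do the
  hitting because disjoint but adjacent subtrees are not separated: no single vertex meets both, but
  an edge can. Singletons stand in at vertices isolated in the current \<open>W\<close>.\<close>

lemma subtree_duality:
  assumes "finite W"
    and "\<And>X. X \<subseteq> W \<Longrightarrow> X \<noteq> {} \<Longrightarrow> \<exists>l\<in>X. \<exists>p. \<forall>q\<in>X. {l, q} \<in> edges T \<longrightarrow> q = p"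
    and "\<And>D. D \<in> \<S> \<Longrightarrow> D \<subseteq> W \<and> connected_set T D"
    and "\<And>P. P \<subseteq> \<S> \<Longrightarrow> pairwise (separated T) P \<Longrightarrow> card P < k"
  shows "\<exists>B. B \<subseteq> edges T \<union> (\<lambda>v. {v}) ` W \<and> finite B \<and> card B < k \<and> (\<forall>D\<in>\<S>. \<exists>b\<in>B. b \<inter> D \<noteq> {})"
  using assms
proof (induction W arbitrary: \<S> k rule: finite_psubset_induct)
  case (psubset W)
  note leaf = psubset.prems(1) and sub = psubset.prems(2) and few = psubset.prems(3)
  have k: "0 < k" using few[of "{}"] by simp
  show ?case
  proof (cases "W = {}")
    case True
    then have "\<S> = {}" using sub by (auto simp: connected_set_def)
    then show ?thesis using k by (intro exI[of _ "{}"]) auto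
  next
    case False
    then obtain l p where l: "l \<in> W" and p: "\<And>q. q \<in> W \<Longrightarrow> {l, q} \<in> edges T \<Longrightarrow> q = p"
      using leaf[of W] by auto
    have W': "W - {l} \<subset> W" using l by auto
    have leaf': "\<exists>l\<in>X. \<exists>p. \<forall>q\<in>X. {l, q} \<in> edges T \<longrightarrow> q = p"
      if "X \<subseteq> W - {l}" "X \<noteq> {}" for X using leaf[of X] that by blast
    have finS: "finite \<S>"
      by (rule finite_subset[of _ "Pow W"]) (use sub psubset.hyps in auto)
    txt \<open>If \<open>{l} \<in> \<S>\<close>, the edge at the leaf \<open>l\<close> meets every member not separated from \<open>{l}\<close>.
      Otherwise \<open>l\<close> can be deleted from all members, as those containing it also contain \<open>p\<close>.\<close>
    show ?thesis
    proof (cases "{l} \<in> \<S>")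
      case True
      define \<S>' where "\<S>' = {D \<in> \<S>. separated T {l} D}"
      have "D \<subseteq> W - {l} \<and> connected_set T D" if "D \<in> \<S>'" for D
        using sub that by (auto simp: \<S>'_def separated_def)
      \<comment> \<open>Adding \<open>{l}\<close> to \<open>P\<close> gives a separated subfamily of
        \<open>\<S>\<close> with one more member, so the bound drops by one.\<close>
      moreover have "card P < k - 1" if P: "P \<subseteq> \<S>'" "pairwise (separated T) P" for P
      proof -
        have "{l} \<notin> P" using P by (auto simp: \<S>'_def separated_def)
        moreover have "finite P" using P finS by (auto simp: \<S>'_def intro: finite_subset)
        moreover have "pairwise (separated T) (insert {l} P)"
          using P by (auto simp: pairwise_insert \<S>'_def intro: separated_sym)
        then have "card (insert {l} P) < k" using P True by (intro few) (auto simp: \<S>'_def)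
        ultimately show ?thesis by simp
      qed
      ultimately obtain B where B: "B \<subseteq> edges T \<union> (\<lambda>v. {v}) ` (W - {l})" "finite B"
          "card B < k - 1" "\<forall>D\<in>\<S>'. \<exists>b\<in>B. b \<inter> D \<noteq> {}"
        using psubset.IH[OF W' leaf', of \<S>' "k - 1"] by blast
      \<comment> \<open>Without a neighbour of \<open>l\<close> in \<open>W\<close> the value of
        \<open>p\<close> is arbitrary, and the singleton replaces the edge.\<close>
      define b where "b = (if \<exists>q\<in>W. {l, q} \<in> edges T then {l, p} else {l})"
      have b: "b \<in> edges T \<union> (\<lambda>v. {v}) ` W" using p l by (auto simp: b_def)
      have hit: "b \<inter> D \<noteq> {}" if "D \<in> \<S>" "D \<notin> \<S>'" for D
      proof -
        have "D \<subseteq> W" using sub that by auto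
        then show ?thesis using that p by (auto simp: \<S>'_def separated_def b_def)
      qed
      have "card (insert b B) < k"
        using B(3) card_insert_le_m1[of "k - 1" B b] by linarith
      moreover have "insert b B \<subseteq> edges T \<union> (\<lambda>v. {v}) ` W" using B(1) b by auto
      moreover have "\<forall>D\<in>\<S>. \<exists>b'\<in>insert b B. b' \<inter> D \<noteq> {}" using B(4) hit by (metis insertCI)
      ultimately show ?thesis using B(2) by (intro exI[of _ "insert b B"]) simp
    next
      case False
      define f where "f D = D - {l}" for D
      have pD: "p \<in> D" if D: "D \<in> \<S>" "l \<in> D" for D
      proof -
        have "{l} \<subset> D" using D False by auto
        then obtain b where "b \<in> D" "{l, b} \<in> edges T"
          using sub[OF D(1)] unfolding connected_set_def by blast
        then show ?thesis using p sub[OF D(1)] by blast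
      qed
      have "f D \<subseteq> W - {l} \<and> connected_set T (f D)" if D: "D \<in> \<S>" for D
      proof -
        have DW: "D \<subseteq> W" and c: "connected_set T D" using sub[OF D] by auto
        have "f D \<noteq> {}" using c False D by (auto simp: f_def connected_set_def subset_singleton_iff)
        moreover have "\<exists>a\<in>A. \<exists>b\<in>f D - A. {a, b} \<in> edges T" if A: "A \<subset> f D" "A \<noteq> {}" for A
        \<comment> \<open>The edge leaving \<open>A\<close> must avoid \<open>l\<close>. If
          \<open>p\<close> is in \<open>A\<close>, the cut at \<open>insert l A\<close> is used, and
          its edge cannot start at \<open>l\<close>; otherwise no edge leads from \<open>A\<close>
          to \<open>l\<close> inside \<open>D\<close>.\<close>
        proof (cases "l \<in> D \<and> p \<in> A")
          case True
          then have "insert l A \<subset> D" using A by (auto simp: f_def)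
          then obtain a b where ab: "a \<in> insert l A" "b \<in> D - insert l A" "{a, b} \<in> edges T"
            using c unfolding connected_set_def by blast
          moreover have "a \<noteq> l" using ab p True DW by blast
          ultimately show ?thesis by (auto simp: f_def)
        next
          case F: False
          have "A \<subset> D" using A by (auto simp: f_def)
          then obtain a b where ab: "a \<in> A" "b \<in> D - A" "{a, b} \<in> edges T"
            using c A unfolding connected_set_def by blast
          have "a \<in> W" using ab A DW by (auto simp: f_def)
          then have "b \<noteq> l" using ab p F by (metis DiffD1 insert_commute)
          with ab show ?thesis by (auto simp: f_def)
        qed
        ultimately show ?thesis using DW by (auto simp: connected_set_def f_def)
      qed
      then have sub': "D \<subseteq> W - {l} \<and> connected_set T D" if "D \<in> f ` \<S>" for D
        using that by blast
      \<comment> \<open>A separated family of reduced sets is lifted to one member of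
        \<open>\<S>\<close> each. An edge between lifted sets that uses \<open>l\<close> has
        \<open>p\<close> as its other end, and \<open>p\<close> also belongs to the set containing
        \<open>l\<close>, against disjointness of the reduced sets.\<close>
      have "card P' < k" if P': "P' \<subseteq> f ` \<S>" "pairwise (separated T) P'" for P'
      proof -
        obtain P where P: "P \<subseteq> \<S>" "inj_on f P" "P' = f ` P"
          using P'(1) unfolding subset_image_inj by blast
        have "separated T C D" if CD: "C \<in> P" "D \<in> P" "C \<noteq> D" for C D
        proof -
          have "f C \<noteq> f D" using inj_onD[OF P(2) _ CD(1,2)] CD(3) by blast
          then have s: "separated T (f C) (f D)"
            using pairwiseD[OF P'(2), of "f C" "f D"] CD P(3) by simp
          have *: "C \<in> \<S>" "D \<in> \<S>" "C \<subseteq> W" "D \<subseteq> W" using CD P sub by auto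
          \<comment> \<open>A common \<open>l\<close> forces a common \<open>p\<close>, which
            disjointness of the reduced sets allows only for \<open>p = l\<close>. The next step
            excludes this, as \<open>l\<close> has a neighbour other than itself in
            \<open>C\<close>.\<close>
          have pl: "p = l" if "l \<in> C" "l \<in> D"
            using s pD[OF *(1) that(1)] pD[OF *(2) that(2)] by (auto simp: separated_def f_def)
          have disj: "\<not> (l \<in> C \<and> l \<in> D)"
          proof
            assume lCD: "l \<in> C \<and> l \<in> D"
            then have "{l} \<subset> C" using *(1) False by blast
            then obtain b where "b \<in> C" "b \<noteq> l" "{l, b} \<in> edges T"
              using sub[OF *(1)] unfolding connected_set_def by blast
            then show False using p[of b] pl lCD *(3) by blast
          qed
          have "{c, d} \<notin> edges T" if cd: "c \<in> C" "d \<in> D" for c d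
          proof
            assume e: "{c, d} \<in> edges T"
            consider "c = l" "d = l" | "c = l" "d \<noteq> l" | "c \<noteq> l" "d = l" | "c \<noteq> l" "d \<noteq> l" by blast
            then show False
            proof cases
              case 1 then show False using disj cd by simp
            next
              case 2
              then have "d = p" using e p[of d] *(4) cd by auto
              then show False using s pD[OF *(1)] cd 2 by (auto simp: separated_def f_def)
            next
              case 3
              then have "c = p" using e p[of c] *(3) cd by (auto simp: insert_commute)
              then show False using s pD[OF *(2)] cd 3 by (auto simp: separated_def f_def)
            next
              case 4 then show False using s e cd by (auto simp: separated_def f_def)
            qed
          qed
          moreover have "C \<inter> D = {}" using s disj by (auto simp: separated_def f_def)
          ultimately show ?thesis by (auto simp: separated_def)
        qed
        then have "card P < k" by (intro few[OF P(1)] pairwiseI)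
        then show ?thesis using P by (simp add: card_image)
      qed
      with sub' obtain B where B: "B \<subseteq> edges T \<union> (\<lambda>v. {v}) ` (W - {l})" "finite B" "card B < k"
          "\<forall>D\<in>f ` \<S>. \<exists>b\<in>B. b \<inter> D \<noteq> {}"
        using psubset.IH[OF W' leaf', of "f ` \<S>" k] by blast
      have "\<exists>b\<in>B. b \<inter> D \<noteq> {}" if DS: "D \<in> \<S>" for D
      proof -
        obtain b where "b \<in> B" "b \<inter> f D \<noteq> {}" using B(4) DS by blast
        then show ?thesis unfolding f_def by blast
      qed
      moreover have "B \<subseteq> edges T \<union> (\<lambda>v. {v}) ` W" using B(1) by blast
      ultimately show ?thesis using B(2,3) by (intro exI[of _ B]) simp
    qed
  qed
qed

text \<open>If \<open>U\<close> is not connected, some cut has no edges, and a component of the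
  smaller side is also a component of \<open>U\<close>.\<close>

lemma connected_component_exists:
  assumes "finite U" "U \<noteq> {}"
  shows "\<exists>C. C \<subseteq> U \<and> connected_set T C \<and> separated T C (U - C)"
  using assms
proof (induction U rule: finite_psubset_induct)
  case (psubset U)
  show ?case
  proof (cases "connected_set T U")
    case True
    then show ?thesis by (intro exI[of _ U]) (simp add: separated_def)
  next
    case False
    then obtain A where A: "A \<subset> U" "A \<noteq> {}" "\<forall>a\<in>A. \<forall>b\<in>U - A. {a, b} \<notin> edges T"
      using psubset.prems unfolding connected_set_def by blast
    from psubset.IH[OF A(1,2)] obtain C where
      C: "C \<subseteq> A" "connected_set T C" "separated T C (A - C)" by blast
    have "separated T C (U - C)" using C A unfolding separated_def by blast
    then show ?thesis using C A by blast
  qed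
qed

section \<open>Sunflowers of functions and disjoint representatives\<close>

lemma card_le_fibers:
  assumes "finite A" "\<And>y. y \<in> f ` A \<Longrightarrow> card {x \<in> A. f x = y} \<le> N"
  shows "card A \<le> N * card (f ` A)"
proof -
  have "card A = card (\<Union>y\<in>f ` A. {x \<in> A. f x = y})" by (rule arg_cong[of _ _ card]) auto
  also have "\<dots> \<le> (\<Sum>y\<in>f ` A. card {x \<in> A. f x = y})" using assms(1) by (intro card_UN_le) auto
  also have "\<dots> \<le> card (f ` A) * N" using sum_bounded_above[of "f ` A" _ N] assms(2) by auto
  finally show ?thesis by (simp add: mult.commute)
qed

text \<open>The kernel consists of arguments rather than values. Off the kernel whole images are
  disjoint, so a value of one function does not recur in another even at a different
  argument.\<close>

definition sunflower :: "'a set \<Rightarrow> 'a set \<Rightarrow> ('a \<Rightarrow> 'b) set \<Rightarrow> bool" where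
  "sunflower V K \<Psi> \<longleftrightarrow> (\<forall>\<phi>\<in>\<Psi>. \<forall>\<psi>\<in>\<Psi>. \<forall>x\<in>K. \<phi> x = \<psi> x) \<and>
     (\<forall>\<phi>\<in>\<Psi>. \<forall>\<psi>\<in>\<Psi>. \<phi> \<noteq> \<psi> \<longrightarrow> \<phi> ` (V - K) \<inter> \<psi> ` (V - K) = {})"

text \<open>The Erdos-Rado argument, by induction on the number \<open>d\<close> of arguments not
  yet fixed by \<open>A\<close>. Either a maximal subfamily with disjoint images off
  \<open>A\<close> is large enough, or its few values are hit by every function and the pigeonhole
  principle fixes one more argument. \<open>K\<close> is a proper subset so that the petals are
  nonempty.\<close>

lemma sunflower_functions:
  fixes V :: "'a set"
  assumes V: "finite V"
  shows "\<exists>N. \<forall>A (\<Phi> :: ('a \<Rightarrow> 'b) set). A \<subseteq> V \<longrightarrow> card (V - A) = d \<longrightarrow> finite \<Phi> \<longrightarrow> N < card \<Phi> \<longrightarrow>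
    \<Phi> \<subseteq> extensional V \<longrightarrow> (\<forall>\<phi>\<in>\<Phi>. \<forall>\<psi>\<in>\<Phi>. \<forall>x\<in>A. \<phi> x = \<psi> x) \<longrightarrow>
    (\<exists>K \<Psi>. A \<subseteq> K \<and> K \<subset> V \<and> \<Psi> \<subseteq> \<Phi> \<and> card \<Psi> = t \<and> sunflower V K \<Psi>)"
proof (induction d)
  case 0
  show ?case
  \<comment> \<open>With every argument fixed, extensional functions coincide, so no family has more
    than one member and the claim is vacuous.\<close>
  proof (intro exI[of _ 1] allI impI)
    fix A and \<Phi> :: "('a \<Rightarrow> 'b) set"
    assume A: "A \<subseteq> V" "card (V - A) = 0" and \<Phi>: "1 < card \<Phi>"
      and ext: "\<Phi> \<subseteq> extensional V" and eq: "\<forall>\<phi>\<in>\<Phi>. \<forall>\<psi>\<in>\<Phi>. \<forall>x\<in>A. \<phi> x = \<psi> x"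
    have "V = A" using A V by auto
    then have "\<phi> = \<psi>" if "\<phi> \<in> \<Phi>" "\<psi> \<in> \<Phi>" for \<phi> \<psi>
      using that ext eq by (intro extensionalityI[of _ V]) auto
    then have "card \<Phi> \<le> Suc 0" using \<Phi> by (subst card_le_Suc0_iff_eq) (auto intro: card_ge_0_finite)
    then show "\<exists>K \<Psi>. A \<subseteq> K \<and> K \<subset> V \<and> \<Psi> \<subseteq> \<Phi> \<and> card \<Psi> = t \<and> sunflower V K \<Psi>"
      using \<Phi> by simp
  qed
next
  case (Suc d)
  obtain N where N0: "\<forall>A (\<Phi> :: ('a \<Rightarrow> 'b) set). A \<subseteq> V \<longrightarrow> card (V - A) = d \<longrightarrow> finite \<Phi> \<longrightarrow> N < card \<Phi> \<longrightarrow>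
    \<Phi> \<subseteq> extensional V \<longrightarrow> (\<forall>\<phi>\<in>\<Phi>. \<forall>\<psi>\<in>\<Phi>. \<forall>x\<in>A. \<phi> x = \<psi> x) \<longrightarrow>
    (\<exists>K \<Psi>. A \<subseteq> K \<and> K \<subset> V \<and> \<Psi> \<subseteq> \<Phi> \<and> card \<Psi> = t \<and> sunflower V K \<Psi>)"
    using Suc.IH by (rule exE)
  note N = N0[THEN spec, THEN spec, THEN mp, THEN mp, THEN mp, THEN mp, THEN mp, THEN mp]
  \<comment> \<open>\<open>N\<close> times a bound on the number of pairs of an argument in
    \<open>V\<close> and a value in a set of at most \<open>t * card V\<close> elements, as the
    pigeonhole step requires.\<close>
  define M where "M = N * (card V * (t * card V))"
  show ?case
  proof (intro exI[of _ M] allI impI)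
    fix A and \<Phi> :: "('a \<Rightarrow> 'b) set"
    assume A: "A \<subseteq> V" "card (V - A) = Suc d" and \<Phi>: "finite \<Phi>" "M < card \<Phi>"
      and ext: "\<Phi> \<subseteq> extensional V" and eq: "\<forall>\<phi>\<in>\<Phi>. \<forall>\<psi>\<in>\<Phi>. \<forall>x\<in>A. \<phi> x = \<psi> x"
    have nonempty: "V - A \<noteq> {}" using A by auto
    define disj where "disj \<Psi> \<longleftrightarrow> \<Psi> \<subseteq> \<Phi> \<and> sunflower V A \<Psi>" for \<Psi>
    have "disj {}" by (simp add: disj_def sunflower_def)
    moreover have "card \<Psi> < Suc (card \<Phi>)" if "disj \<Psi>" for \<Psi>
      using that \<Phi> card_mono[of \<Phi> \<Psi>] by (simp add: disj_def)
    ultimately obtain \<Psi> where \<Psi>: "disj \<Psi>" and max: "\<And>\<Psi>'. disj \<Psi>' \<Longrightarrow> card \<Psi>' \<le> card \<Psi>"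
      by (metis ex_has_greatest_nat)
    show "\<exists>K \<Psi>. A \<subseteq> K \<and> K \<subset> V \<and> \<Psi> \<subseteq> \<Phi> \<and> card \<Psi> = t \<and> sunflower V K \<Psi>"
    proof (cases "t \<le> card \<Psi>")
      case True
      then obtain \<Psi>' where \<Psi>': "\<Psi>' \<subseteq> \<Psi>" "card \<Psi>' = t" by (meson obtain_subset_with_card_n)
      then have "sunflower V A \<Psi>'" using \<Psi> unfolding disj_def sunflower_def by (meson subsetD)
      then show ?thesis using \<Psi> \<Psi>' A nonempty unfolding disj_def
        by (intro exI[of _ A] exI[of _ \<Psi>']) auto
    next
      case False
      have fin\<Psi>: "finite \<Psi>" using \<Psi> \<Phi> by (auto simp: disj_def intro: finite_subset)
      define W where "W = (\<Union>\<psi>\<in>\<Psi>. \<psi> ` (V - A))"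
      have finW: "finite W" using fin\<Psi> V by (simp add: W_def)
      have "card (\<psi> ` (V - A)) \<le> card V" for \<psi> :: "'a \<Rightarrow> 'b"
        using V by (meson Diff_subset card_image_le card_mono finite_Diff le_trans)
      then have "card W \<le> card \<Psi> * card V" unfolding W_def
        using card_UN_le[OF fin\<Psi>, of "\<lambda>\<psi>. \<psi> ` (V - A)"]
          sum_bounded_above[of \<Psi> "\<lambda>\<psi>. card (\<psi> ` (V - A))" "card V"] by fastforce
      then have cW: "card W \<le> t * card V" using False
        by (meson le_trans mult_le_mono1 nat_le_linear)
      \<comment> \<open>A function missing \<open>W\<close> off \<open>A\<close> could be added to
        the maximal \<open>\<Psi>\<close>; members of \<open>\<Psi>\<close> themselves hit
        \<open>W\<close> because \<open>V - A\<close> is nonempty.\<close>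
      have hit: "\<exists>x. x \<in> V - A \<and> \<phi> x \<in> W" if \<phi>: "\<phi> \<in> \<Phi>" for \<phi>
      proof (cases "\<phi> \<in> \<Psi>")
        case True
        then show ?thesis using nonempty by (auto simp: W_def)
      next
        case F: False
        have "\<not> disj (insert \<phi> \<Psi>)" using max[of "insert \<phi> \<Psi>"] F fin\<Psi> by auto
        then have "\<not> sunflower V A (insert \<phi> \<Psi>)" using \<Psi> \<phi> by (simp add: disj_def)
        moreover have "\<forall>\<phi>'\<in>insert \<phi> \<Psi>. \<forall>\<psi>\<in>insert \<phi> \<Psi>. \<forall>x\<in>A. \<phi>' x = \<psi> x"
          using eq \<Psi> \<phi> unfolding disj_def by (meson insert_subset subsetD)
        ultimately obtain \<psi> where "\<psi> \<in> \<Psi>" "\<phi> ` (V - A) \<inter> \<psi> ` (V - A) \<noteq> {}"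
          using \<Psi> unfolding disj_def sunflower_def by (metis Int_commute insert_iff)
        then show ?thesis unfolding W_def by blast
      qed
      define x where "x \<phi> = (SOME x. x \<in> V - A \<and> \<phi> x \<in> W)" for \<phi>
      have x: "x \<phi> \<in> V - A \<and> \<phi> (x \<phi>) \<in> W" if "\<phi> \<in> \<Phi>" for \<phi>
        unfolding x_def by (rule someI_ex) (rule hit[OF that])
      define h where "h \<phi> = (x \<phi>, \<phi> (x \<phi>))" for \<phi>
      have "h ` \<Phi> \<subseteq> V \<times> W" using x by (auto simp: h_def)
      then have "card (h ` \<Phi>) \<le> card V * card W"
        using card_mono[of "V \<times> W"] V finW by (simp add: card_cartesian_product)
      also have "\<dots> \<le> card V * (t * card V)" using cW by simp
      finally have "N * card (h ` \<Phi>) \<le> M" by (simp add: M_def)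
      \<comment> \<open>More than \<open>N\<close> functions share the argument and the value in
        \<open>y\<close>; this argument joins \<open>A\<close> and the induction hypothesis
        applies.\<close>
      then obtain y where y: "y \<in> h ` \<Phi>" "N < card {\<phi> \<in> \<Phi>. h \<phi> = y}"
        using card_le_fibers[OF \<Phi>(1), of h N] \<Phi>(2) by (meson le_trans not_le)
      define \<Phi>' where "\<Phi>' = {\<phi> \<in> \<Phi>. h \<phi> = y}"
      have fst: "fst y \<in> V - A" using y x by (auto simp: h_def)
      have "card (V - insert (fst y) A) = d"
        using A fst V by (metis card_Diff_singleton Diff_insert diff_Suc_1)
      moreover have "\<forall>\<phi>\<in>\<Phi>'. \<forall>\<psi>\<in>\<Phi>'. \<forall>x\<in>insert (fst y) A. \<phi> x = \<psi> x"
        using eq by (auto simp: \<Phi>'_def h_def)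
      ultimately have "\<exists>K \<Psi>'. insert (fst y) A \<subseteq> K \<and> K \<subset> V \<and> \<Psi>' \<subseteq> \<Phi>' \<and> card \<Psi>' = t \<and> sunflower V K \<Psi>'"
        using A fst \<Phi>(1) y(2) ext by (intro N) (auto simp: \<Phi>'_def)
      then show ?thesis unfolding \<Phi>'_def by blast
    qed
  qed
qed

text \<open>Greedy choice: at each index, \<open>X\<close> and the sets chosen so far have together
  at most \<open>s * Suc (card I)\<close> elements, and as the candidates for one index are pairwise
  disjoint, each such element rules out at most one of them.\<close>

lemma disjoint_representatives:
  assumes "finite I" "finite X" "card X \<le> s"
    and "\<And>i \<psi>. i \<in> I \<Longrightarrow> \<psi> \<in> \<Psi> i \<Longrightarrow> finite (h i \<psi>) \<and> card (h i \<psi>) \<le> s"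
    and "\<And>i \<phi> \<psi>. i \<in> I \<Longrightarrow> \<phi> \<in> \<Psi> i \<Longrightarrow> \<psi> \<in> \<Psi> i \<Longrightarrow> \<phi> \<noteq> \<psi> \<Longrightarrow> h i \<phi> \<inter> h i \<psi> = {}"
    and "\<And>i. i \<in> I \<Longrightarrow> s * Suc (card I) < card (\<Psi> i)"
  shows "\<exists>g. \<forall>i\<in>I. g i \<in> \<Psi> i \<and> h i (g i) \<inter> X = {} \<and>
           (\<forall>j\<in>I. i \<noteq> j \<longrightarrow> h i (g i) \<inter> h j (g j) = {})"
  using assms
proof (induction I rule: finite_induct)
  case (insert k I)
  have "s * Suc (card I) < card (\<Psi> i)" if "i \<in> I" for i
    using insert.prems(5)[of i] insert.hyps that by simp
  then have "\<exists>g. \<forall>i\<in>I. g i \<in> \<Psi> i \<and> h i (g i) \<inter> X = {} \<and>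
      (\<forall>j\<in>I. i \<noteq> j \<longrightarrow> h i (g i) \<inter> h j (g j) = {})"
    using insert.prems(1-4) by (intro insert.IH) auto
  then obtain g where g: "\<And>i. i \<in> I \<Longrightarrow> g i \<in> \<Psi> i \<and> h i (g i) \<inter> X = {} \<and>
      (\<forall>j\<in>I. i \<noteq> j \<longrightarrow> h i (g i) \<inter> h j (g j) = {})" by blast
  define Y where "Y = X \<union> (\<Union>i\<in>I. h i (g i))"
  have finY: "finite Y" using insert g by (auto simp: Y_def)
  have "card (\<Union>i\<in>I. h i (g i)) \<le> card I * s"
    using card_UN_le[OF insert.hyps(1), of "\<lambda>i. h i (g i)"]
      sum_bounded_above[of I "\<lambda>i. card (h i (g i))" s] g insert.prems(3) by fastforce
  then have cY: "card Y \<le> s * Suc (card I)"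
    using card_Un_le[of X "\<Union>i\<in>I. h i (g i)"] insert.prems(2) by (simp add: Y_def mult.commute)
  have "\<exists>\<psi>\<in>\<Psi> k. h k \<psi> \<inter> Y = {}"
  proof (rule ccontr)
    assume "\<not> ?thesis"
    then have "\<forall>\<psi>\<in>\<Psi> k. \<exists>y. y \<in> h k \<psi> \<inter> Y" by blast
    then obtain y where y: "\<And>\<psi>. \<psi> \<in> \<Psi> k \<Longrightarrow> y \<psi> \<in> h k \<psi> \<inter> Y" by metis
    have "inj_on y (\<Psi> k)"
    proof (rule inj_onI, rule ccontr)
      fix \<phi> \<psi> assume "\<phi> \<in> \<Psi> k" "\<psi> \<in> \<Psi> k" "y \<phi> = y \<psi>" "\<phi> \<noteq> \<psi>"
      then show False using insert.prems(4)[of k \<phi> \<psi>] y[of \<phi>] y[of \<psi>] by auto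
    qed
    then have "card (\<Psi> k) \<le> card Y" using y finY by (intro card_inj_on_le[of y]) auto
    then show False using cY insert.prems(5)[of k] insert.hyps by simp
  qed
  then obtain \<psi> where \<psi>: "\<psi> \<in> \<Psi> k" "h k \<psi> \<inter> Y = {}" by blast
  have k: "h k \<psi> \<inter> X = {}" "h k \<psi> \<inter> h i (g i) = {}" "i \<noteq> k" if "i \<in> I" for i
    using \<psi>(2) that insert.hyps by (auto simp: Y_def)
  have "h k \<psi> \<inter> X = {}" using \<psi>(2) by (auto simp: Y_def)
  then show ?case
    using g \<psi>(1) k by (intro exI[of _ "g(k := \<psi>)"]) (simp add: Int_commute)
qed simp

section \<open>Copies as images of embeddings\<close>

abbreviation graph_image :: "('a \<Rightarrow> 'b) \<Rightarrow> 'a graph \<Rightarrow> 'b graph" where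
  "graph_image f G \<equiv> Graph (f ` verts G) ((\<lambda>e. f ` e) ` edges G)"

lemma simple_graphD:
  "simple_graph G \<Longrightarrow> finite (verts G)"
  "simple_graph G \<Longrightarrow> e \<in> edges G \<Longrightarrow> e \<subseteq> verts G"
  "simple_graph G \<Longrightarrow> e \<in> edges G \<Longrightarrow> card e = 2"
  by (auto simp: simple_graph_def)

lemma simple_edge_distinct: "simple_graph G \<Longrightarrow> {x, y} \<in> edges G \<Longrightarrow> x \<in> verts G \<and> y \<in> verts G \<and> x \<noteq> y"
  by (fastforce simp: simple_graph_def)

lemma finite_edges: "simple_graph G \<Longrightarrow> finite (edges G)"
  by (rule finite_subset[of _ "Pow (verts G)"]) (auto simp: simple_graph_def)

lemma restrict_embedding:
  assumes "simple_graph H" "inj_on f (verts H)" "f ` verts H \<subseteq> verts G"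
    "\<And>e. e \<in> edges H \<Longrightarrow> f ` e \<in> edges G"
  shows "restrict f (verts H) \<in> embeddings H G"
proof -
  have "restrict f (verts H) ` e = f ` e" if "e \<in> edges H" for e
    using simple_graphD(2)[OF assms(1) that] by (intro image_cong) auto
  then show ?thesis using assms unfolding embeddings_def by auto
qed

lemma finite_embeddings: "simple_graph H \<Longrightarrow> simple_graph G \<Longrightarrow> finite (embeddings H G)"
  unfolding embeddings_def
  by (rule finite_subset[of _ "verts H \<rightarrow>\<^sub>E verts G"]) (auto simp: simple_graph_def intro: finite_PiE)

lemma graph_image_cong:
  assumes "simple_graph H" "\<And>x. x \<in> verts H \<Longrightarrow> f x = g x"
  shows "graph_image f H = graph_image g H"
proof -
  have "f ` e = g ` e" if "e \<in> edges H" for e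
    using simple_graphD(2)[OF assms(1) that] assms(2) by (intro image_cong) auto
  then show ?thesis using assms(2) by (simp cong: image_cong)
qed

text \<open>Reduces counting and excluding copies to embeddings. Several embeddings may give the
  same copy, so the number of embeddings bounds the number of copies from above.\<close>

lemma copies_eq_image_embeddings:
  assumes H: "simple_graph H"
  shows "copies H G = (\<lambda>\<phi>. graph_image \<phi> H) ` embeddings H G"
proof (intro equalityI subsetI)
  fix K assume "K \<in> copies H G"
  then obtain f where K: "subgraph K G" and f: "bij_betw f (verts H) (verts K)"
      "edges K = (\<lambda>e. f ` e) ` edges H"
    by (auto simp: copies_def graph_iso_def)
  have "restrict f (verts H) \<in> embeddings H G"
    using K f by (intro restrict_embedding[OF H]) (auto simp: subgraph_def bij_betw_def)
  moreover have "K = graph_image (restrict f (verts H)) H"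
    using f graph_image_cong[OF H, of "restrict f (verts H)" f]
    by (cases K) (auto simp: bij_betw_def)
  ultimately show "K \<in> (\<lambda>\<phi>. graph_image \<phi> H) ` embeddings H G" by blast
next
  fix K assume "K \<in> (\<lambda>\<phi>. graph_image \<phi> H) ` embeddings H G"
  then obtain \<phi> where \<phi>: "\<phi> \<in> embeddings H G" and K: "K = graph_image \<phi> H" by blast
  have inj: "inj_on \<phi> (verts H)" using \<phi> by (simp add: embeddings_def)
  have "card (\<phi> ` e) = 2" if "e \<in> edges H" for e
    using inj_on_subset[OF inj] simple_graphD(2,3)[OF H that] by (simp add: card_image)
  then have "simple_graph K"
    using H by (auto simp: K simple_graph_def)
  then have "subgraph K G" using \<phi> by (auto simp: K subgraph_def embeddings_def)
  moreover have "graph_iso H K" using inj unfolding graph_iso_def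
    by (intro exI[of _ \<phi>]) (simp add: K bij_betw_def)
  ultimately show "K \<in> copies H G" by (simp add: copies_def)
qed

text \<open>By composition, a member of \<open>\<F>\<close> embedded in \<open>G\<close> would also
  embed in \<open>K\<close>.\<close>

lemma free_of_embedding:
  assumes simple: "\<And>H. H \<in> \<F> \<Longrightarrow> simple_graph H" and K: "free_of \<F> K"
    and \<psi>: "\<psi> \<in> embeddings G K"
  shows "free_of \<F> G"
  unfolding free_of_def
proof (rule ballI, rule ccontr)
  fix H assume H: "H \<in> \<F>" and "copies H G \<noteq> {}"
  then obtain \<phi> where \<phi>: "\<phi> \<in> embeddings H G"
    using copies_eq_image_embeddings[OF simple[OF H]] by auto
  have sub: "\<phi> ` verts H \<subseteq> verts G" using \<phi> by (auto simp: embeddings_def)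
  have "restrict (\<psi> \<circ> \<phi>) (verts H) \<in> embeddings H K"
  proof (rule restrict_embedding[OF simple[OF H]])
    show "inj_on (\<psi> \<circ> \<phi>) (verts H)"
      using \<phi> \<psi> sub by (intro comp_inj_on) (auto simp: embeddings_def intro: inj_on_subset)
    show "(\<psi> \<circ> \<phi>) ` verts H \<subseteq> verts K" using \<psi> sub by (auto simp: embeddings_def)
    show "(\<psi> \<circ> \<phi>) ` e \<in> edges K" if "e \<in> edges H" for e
      using \<phi> \<psi> that unfolding embeddings_def image_comp[symmetric] by blast
  qed
  then have "copies H K \<noteq> {}" using copies_eq_image_embeddings[OF simple[OF H], of K] by auto
  then show False using K H by (simp add: free_of_def)
qed

section \<open>Blow-ups and the copies of \<open>T\<close> they contain\<close>

lemma verts_blowup: "verts (blowup T U t) = {(x, i). x \<in> verts T \<and> i < (if x \<in> U then t else 1)}"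
  by (simp add: blowup_def Let_def)

lemma edges_blowup: "edges (blowup T U t) = {{(x, i), (y, j)} | x i y j.
    (x, i) \<in> verts (blowup T U t) \<and> (y, j) \<in> verts (blowup T U t) \<and> {x, y} \<in> edges T \<and>
    (x \<in> U \<longrightarrow> y \<in> U \<longrightarrow> i = j)}"
  by (simp add: blowup_def Let_def)

lemma blowup_mono:
  assumes "t \<le> t'"
  shows "verts (blowup T U t) \<subseteq> verts (blowup T U t')" "edges (blowup T U t) \<subseteq> edges (blowup T U t')"
proof -
  show v: "verts (blowup T U t) \<subseteq> verts (blowup T U t')" using assms by (auto simp: verts_blowup)
  show "edges (blowup T U t) \<subseteq> edges (blowup T U t')" unfolding edges_blowup using v by blast
qed

lemma verts_blowup_subset: "0 < t \<Longrightarrow> verts (blowup T U t) \<subseteq> verts T \<times> {..<t}"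
  by (auto simp: verts_blowup split: if_splits)

lemma simple_blowup:
  assumes T: "simple_graph T"
  shows "simple_graph (blowup T U t)"
proof -
  have "finite (verts (blowup T U t))"
    by (rule finite_subset[of _ "verts T \<times> {..<Suc t}"])
      (use T in \<open>auto simp: verts_blowup simple_graph_def split: if_splits\<close>)
  moreover have "e \<subseteq> verts (blowup T U t) \<and> card e = 2" if "e \<in> edges (blowup T U t)" for e
    using that simple_edge_distinct[OF T] unfolding edges_blowup by (fastforce simp: card_2_iff)
  ultimately show ?thesis by (simp add: simple_graph_def)
qed

text \<open>Unspecified outside \<open>\<Union>P\<close>, so every use is guarded by membership in
  \<open>\<Union>P\<close>.\<close>

definition part :: "'a set set \<Rightarrow> 'a \<Rightarrow> 'a set" where
  "part P x = (THE C. C \<in> P \<and> x \<in> C)"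

lemma part_eq:
  assumes "pairwise (separated T) P" "C \<in> P" "x \<in> C"
  shows "part P x = C"
  unfolding part_def using assms by (intro the_equality) (auto simp: pairwise_def separated_def)

lemma finite_free_graphs: "finite (free_graphs n \<F>)"
proof (rule finite_subset)
  show "free_graphs n \<F> \<subseteq> (\<lambda>(V, E). Graph V E) ` (Pow {..<n} \<times> Pow (Pow {..<n}))"
  proof
    fix G assume "G \<in> free_graphs n \<F>"
    then show "G \<in> (\<lambda>(V, E). Graph V E) ` (Pow {..<n} \<times> Pow (Pow {..<n}))"
      by (cases G) (auto simp: free_graphs_def simple_graph_def)
  qed
qed auto

text \<open>The host is the \<open>t\<close>-fold blow-up padded to \<open>n\<close> vertices. Each
  function from \<open>P\<close> to \<open>{..<t}\<close> selects one clone per part and yields a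
  copy of \<open>T\<close>; different selections give different vertex sets.\<close>

lemma gen_ex_ge_of_free_blowups:
  fixes T :: "'a graph" and \<F> :: "'c graph set"
  assumes T: "simple_graph T" and simple: "\<And>H. H \<in> \<F> \<Longrightarrow> simple_graph H"
    and P: "pairwise (separated T) P" "\<And>C. C \<in> P \<Longrightarrow> C \<noteq> {} \<and> C \<subseteq> verts T" "P \<noteq> {}"
    and free: "\<And>t. free_of \<F> (blowup T (\<Union>P) t)"
    and t: "0 < t" "t * card (verts T) \<le> n"
  shows "t ^ card P \<le> gen_ex n T \<F>"
proof -
  let ?B = "blowup T (\<Union>P)"
  have finV: "finite (verts T)" using T by (simp add: simple_graph_def)
  have finP: "finite P" by (rule finite_subset[of _ "Pow (verts T)"]) (use P(2) finV in auto)
  obtain C0 x0 where x0: "C0 \<in> P" "x0 \<in> C0" using P(2,3) by blast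
  then have x0T: "x0 \<in> verts T" using P(2) by blast
  have "0 < card (verts T)" using x0T finV by (auto simp: card_gt_0_iff)
  then have tn: "t \<le> n" using t(2) by (metis Suc_leI One_nat_def le_trans mult.right_neutral mult_le_mono2)
  have "card (verts (?B t)) \<le> card (verts T \<times> {..<t})"
    using finV verts_blowup_subset[OF t(1)] by (intro card_mono) auto
  then have "card (verts (?B t)) \<le> n" using t(2) by (simp add: card_cartesian_product mult.commute)
  \<comment> \<open>The \<open>n\<close> clones of \<open>x0\<close> make the \<open>n\<close>-fold
    blow-up large enough to contain a set of exactly \<open>n\<close> vertices around the
    \<open>t\<close>-fold one.\<close>
  moreover have "card ({x0} \<times> {..<n}) \<le> card (verts (?B n))"
    using x0 x0T by (intro card_mono simple_graphD(1)[OF simple_blowup[OF T]]) (auto simp: verts_blowup)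
  then have "n \<le> card (verts (?B n))" by simp
  ultimately obtain W where W: "verts (?B t) \<subseteq> W" "W \<subseteq> verts (?B n)" "card W = n"
    using exists_subset_between[of "verts (?B t)" n "verts (?B n)"] blowup_mono(1)[OF tn]
      simple_graphD(1)[OF simple_blowup[OF T]] by metis
  have finW: "finite W" using W(2) simple_graphD(1)[OF simple_blowup[OF T]] by (rule finite_subset)
  then obtain f where f: "bij_betw f W {..<n}"
    using W(3) finite_same_card_bij[of W "{..<n}"] by auto
  \<comment> \<open>Vertices of \<open>W\<close> outside the \<open>t\<close>-fold blow-up become
    isolated.\<close>
  define G where "G = Graph {..<n} ((\<lambda>e. f ` e) ` edges (?B t))"
  have eW: "e \<subseteq> W" if "e \<in> edges (?B t)" for e
    using simple_graphD(2)[OF simple_blowup[OF T] that] W(1) by blast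
  have fW: "f ` W = {..<n}" and injf: "inj_on f W" using f by (auto simp: bij_betw_def)
  have G: "simple_graph G"
  proof -
    have "card (f ` e) = 2" if "e \<in> edges (?B t)" for e
      using simple_graphD(3)[OF simple_blowup[OF T] that] inj_on_subset[OF injf eW[OF that]]
      by (simp add: card_image)
    then show ?thesis using eW fW by (fastforce simp: G_def simple_graph_def)
  qed
  \<comment> \<open>Members of \<open>\<F>\<close> may have isolated vertices, so padding could
    destroy freeness. It is inherited from the \<open>n\<close>-fold blow-up instead, into which
    \<open>G\<close> embeds by the inverse of \<open>f\<close>.\<close>
  have "restrict (inv_into W f) (verts G) \<in> embeddings G (?B n)"
  proof (rule restrict_embedding[OF G])
    show "inj_on (inv_into W f) (verts G)" by (simp add: G_def fW inj_on_inv_into)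
    show "inv_into W f ` verts G \<subseteq> verts (?B n)"
      using W(2) fW inv_into_into[of _ f W] by (fastforce simp: G_def)
    show "inv_into W f ` e \<in> edges (?B n)" if eG: "e \<in> edges G" for e
    proof -
      obtain e' where e': "e' \<in> edges (?B t)" "e = f ` e'" using eG by (auto simp: G_def)
      then have "inv_into W f ` e = e'" using injf eW by (simp add: inv_into_image_cancel)
      then show ?thesis using e' blowup_mono(2)[OF tn, of T "\<Union>P"] by auto
    qed
  qed
  then have "free_of \<F> G" using free_of_embedding[OF simple free] by blast
  then have GF: "G \<in> free_graphs n \<F>" using G by (simp add: free_graphs_def G_def)
  \<comment> \<open>\<open>c\<close> assigns a clone index to each part; vertices outside all parts
    exist only with index 0.\<close>
  define g where "g c x = (x, if x \<in> \<Union>P then c (part P x) else 0 :: nat)" for c x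
  have gB: "g c x \<in> verts (?B t)" if c: "c \<in> P \<rightarrow>\<^sub>E {..<t}" and x: "x \<in> verts T" for c x
  proof (cases "x \<in> \<Union>P")
    case True
    then obtain C where C: "C \<in> P" "x \<in> C" by blast
    then have "part P x = C" by (rule part_eq[OF P(1)])
    moreover have "c C < t" using c C by blast
    ultimately show ?thesis using True x by (simp add: g_def verts_blowup)
  next
    case False
    then show ?thesis using x by (simp add: g_def verts_blowup)
  qed
  have emb: "restrict (f \<circ> g c) (verts T) \<in> embeddings T G" if c: "c \<in> P \<rightarrow>\<^sub>E {..<t}" for c
  proof (rule restrict_embedding[OF T])
    have gW: "g c ` verts T \<subseteq> W" using gB[OF c] W(1) by blast
    show "inj_on (f \<circ> g c) (verts T)"
      by (rule comp_inj_on[OF _ inj_on_subset[OF injf gW]]) (simp add: inj_on_def g_def)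
    show "(f \<circ> g c) ` verts T \<subseteq> verts G" using gW fW by (auto simp: G_def)
    show "(f \<circ> g c) ` e \<in> edges G" if e: "e \<in> edges T" for e
    proof -
      obtain x y where xy: "e = {x, y}" using simple_graphD(3)[OF T e] by (auto simp: card_2_iff)
      have V: "x \<in> verts T" "y \<in> verts T" using simple_graphD(2)[OF T e] xy by auto
      \<comment> \<open>Distinct parts are non-adjacent, so both ends of an edge inside
        \<open>\<Union>P\<close> lie in one part and receive the same index, as edges of the blow-up
        require.\<close>
      have "part P x = part P y" if xyP: "x \<in> \<Union>P" "y \<in> \<Union>P"
      proof -
        obtain C D where CD: "C \<in> P" "D \<in> P" "x \<in> C" "y \<in> D" using xyP by blast
        then have "\<not> separated T C D" using e xy by (auto simp: separated_def)
        then have "C = D" using pairwiseD[OF P(1)] CD by blast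
        then show ?thesis using CD part_eq[OF P(1)] by simp
      qed
      then have "x \<in> \<Union>P \<longrightarrow> y \<in> \<Union>P \<longrightarrow> snd (g c x) = snd (g c y)" by (simp add: g_def)
      moreover have "g c x = (x, snd (g c x))" "g c y = (y, snd (g c y))" by (simp_all add: g_def)
      moreover have "{x, y} \<in> edges T" using e xy by simp
      ultimately have "{g c x, g c y} \<in> edges (?B t)"
        using gB[OF c V(1)] gB[OF c V(2)] unfolding edges_blowup mem_Collect_eq by metis
      then have "f ` {g c x, g c y} \<in> edges G" unfolding G_def graph.sel by (rule imageI)
      then show ?thesis by (simp add: xy)
    qed
  qed
  define copy where "copy c = graph_image (restrict (f \<circ> g c) (verts T)) T" for c
  \<comment> \<open>A copy uses exactly one clone of each vertex of \<open>T\<close>, so the index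
    at any vertex of \<open>C\<close> recovers \<open>c C\<close> from the vertex set alone.\<close>
  have "inj_on copy (P \<rightarrow>\<^sub>E {..<t})"
  proof (rule inj_onI)
    fix c c' assume c: "c \<in> P \<rightarrow>\<^sub>E {..<t}" "c' \<in> P \<rightarrow>\<^sub>E {..<t}" and "copy c = copy c'"
    then have "f ` g c ` verts T = f ` g c' ` verts T" by (simp add: copy_def image_comp)
    moreover have "g c ` verts T \<subseteq> W" "g c' ` verts T \<subseteq> W" using gB c W(1) by blast+
    ultimately have eq: "g c ` verts T = g c' ` verts T" using injf by (simp add: inj_on_image_eq_iff)
    show "c = c'"
    proof (rule PiE_ext[OF c])
      fix C assume C: "C \<in> P"
      then obtain x where x: "x \<in> C" "x \<in> verts T" using P(2) by blast
      then have "g c x \<in> g c' ` verts T" using eq imageI by metis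
      then obtain z where z: "g c x = g c' z" by blast
      have "fst (g c x) = x" "fst (g c' z) = z" by (simp_all add: g_def)
      then have "g c x = g c' x" using z by simp
      moreover have "x \<in> \<Union>P" "part P x = C" using x C part_eq[OF P(1) C] by blast+
      ultimately show "c C = c' C" by (simp add: g_def)
    qed
  qed
  moreover have "copy ` (P \<rightarrow>\<^sub>E {..<t}) \<subseteq> copies T G"
    using emb unfolding copies_eq_image_embeddings[OF T] copy_def by blast
  moreover have "finite (copies T G)"
    unfolding copies_eq_image_embeddings[OF T] using finite_embeddings[OF T G] by simp
  ultimately have "card (P \<rightarrow>\<^sub>E {..<t}) \<le> card (copies T G)" by (intro card_inj_on_le)
  then have "t ^ card P \<le> card (copies T G)" using finP by (simp add: card_PiE)
  also have "\<dots> \<le> gen_ex n T \<F>"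
    using GF finite_free_graphs[of n \<F>] by (auto simp: gen_ex_def intro!: Max_ge)
  finally show ?thesis .
qed

section \<open>Gluing re-embeddings; flexible sets\<close>

text \<open>For each part, \<open>t\<close> re-embeddings are chosen whose images of the part avoid
  each other, those of the other parts and the image of \<open>\<phi>\<close>. Clone
  \<open>i\<close> of a part follows the \<open>i\<close>-th choice, all other vertices follow
  \<open>\<phi>\<close>; agreement on the boundary preserves the edges between a part and the
  rest.\<close>

lemma blowup_embeds:
  fixes T :: "'a graph" and G :: "'b graph"
  assumes T: "simple_graph T"
    and P: "pairwise (separated T) P" "\<And>C. C \<in> P \<Longrightarrow> C \<subseteq> verts T"
    and \<phi>: "\<phi> \<in> embeddings T G"
    and \<Psi>: "\<And>C. C \<in> P \<Longrightarrow> \<Psi> C \<subseteq> embeddings T G"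
    and boundary: "\<And>C \<psi> x y. C \<in> P \<Longrightarrow> \<psi> \<in> \<Psi> C \<Longrightarrow> x \<in> verts T - C \<Longrightarrow> y \<in> C \<Longrightarrow>
      {x, y} \<in> edges T \<Longrightarrow> \<psi> x = \<phi> x"
    and disj: "\<And>C \<psi> \<psi>'. C \<in> P \<Longrightarrow> \<psi> \<in> \<Psi> C \<Longrightarrow> \<psi>' \<in> \<Psi> C \<Longrightarrow> \<psi> \<noteq> \<psi>' \<Longrightarrow> \<psi> ` C \<inter> \<psi>' ` C = {}"
    and large: "\<And>C. C \<in> P \<Longrightarrow> card (verts T) * Suc (card P * t) < card (\<Psi> C)"
  shows "embeddings (blowup T (\<Union>P) t) G \<noteq> {}"
proof -
  have finV: "finite (verts T)" using T by (simp add: simple_graph_def)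
  have finP: "finite P" by (rule finite_subset[of _ "Pow (verts T)"]) (use P(2) finV in auto)
  \<comment> \<open>Indices are pairs of a part and a clone number, hence the term
    \<open>card P * t\<close> in the size condition; the set to be avoided is the image of
    \<open>\<phi>\<close>.\<close>
  obtain g0 where g0: "\<forall>i\<in>P \<times> {..<t}. g0 i \<in> \<Psi> (fst i) \<and> g0 i ` fst i \<inter> \<phi> ` verts T = {} \<and>
      (\<forall>j\<in>P \<times> {..<t}. i \<noteq> j \<longrightarrow> g0 i ` fst i \<inter> g0 j ` fst j = {})"
  proof (atomize_elim, rule disjoint_representatives)
    show "card (\<phi> ` verts T) \<le> card (verts T)" using finV by (rule card_image_le)
    show "finite (\<psi> ` fst i) \<and> card (\<psi> ` fst i) \<le> card (verts T)" if "i \<in> P \<times> {..<t}" for i and \<psi> :: "'a \<Rightarrow> 'b"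
      using that P(2) finV
      by (metis card_image_le card_mono finite_imageI le_trans mem_Times_iff rev_finite_subset)
    show "\<phi>' ` fst i \<inter> \<psi> ` fst i = {}"
      if "i \<in> P \<times> {..<t}" "\<phi>' \<in> \<Psi> (fst i)" "\<psi> \<in> \<Psi> (fst i)" "\<phi>' \<noteq> \<psi>" for i \<phi>' \<psi>
      using that by (intro disj) auto
  qed (use finP finV large in \<open>auto simp: card_cartesian_product\<close>)
  define g where "g C i = g0 (C, i)" for C i
  have g: "g C i \<in> \<Psi> C" "g C i ` C \<inter> \<phi> ` verts T = {}" if "C \<in> P" "i < t" for C i
    using g0 that by (auto simp: g_def dest!: bspec[of _ _ "(C, i)"])
  have g3: "g C i ` C \<inter> g D j ` D = {}"
    if "C \<in> P" "i < t" "D \<in> P" "j < t" "(C, i) \<noteq> (D, j)" for C i D j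
  proof -
    have "g0 (C, i) ` fst (C, i) \<inter> g0 (D, j) ` fst (D, j) = {}"
      using g0 that by (meson SigmaI lessThan_iff)
    then show ?thesis by (simp add: g_def)
  qed
  have gE: "g C i \<in> embeddings T G" if "C \<in> P" "i < t" for C i using g(1) \<Psi> that by blast
  define h where "h = (\<lambda>(x, i). if x \<in> \<Union>P then g (part P x) i x else \<phi> x)"
  have h1: "h (x, i) = g C i x" if "C \<in> P" "x \<in> C" for x i C
    using that part_eq[OF P(1) that] by (auto simp: h_def)
  have h2: "h (x, i) = \<phi> x" if "x \<notin> \<Union>P" for x i using that by (simp add: h_def)
  have vB: "x \<in> verts T \<and> ((\<exists>C\<in>P. x \<in> C \<and> i < t) \<or> x \<notin> \<Union>P \<and> i = 0)"
    if "(x, i) \<in> verts (blowup T (\<Union>P) t)" for x i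
    using that by (auto simp: verts_blowup split: if_splits)
  have "restrict h (verts (blowup T (\<Union>P) t)) \<in> embeddings (blowup T (\<Union>P) t) G"
  proof (rule restrict_embedding[OF simple_blowup[OF T]])
    show "inj_on h (verts (blowup T (\<Union>P) t))"
    proof (rule inj_onI, clarify)
      fix x i y j assume xi: "(x, i) \<in> verts (blowup T (\<Union>P) t)" and yj: "(y, j) \<in> verts (blowup T (\<Union>P) t)"
        and eq: "h (x, i) = h (y, j)"
      consider (both) C D where "C \<in> P" "x \<in> C" "i < t" "D \<in> P" "y \<in> D" "j < t"
        | (left) C where "C \<in> P" "x \<in> C" "i < t" "y \<notin> \<Union>P"
        | (right) D where "D \<in> P" "y \<in> D" "j < t" "x \<notin> \<Union>P"
        | (none) "x \<notin> \<Union>P" "y \<notin> \<Union>P" "i = 0" "j = 0" using vB[OF xi] vB[OF yj]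
        by (elim conjE disjE bexE) (rule that; assumption)+
      then show "x = y \<and> i = j"
      proof cases
        case both
        then have e: "g C i x = g D j y" using eq h1 by simp
        then have "g C i ` C \<inter> g D j ` D \<noteq> {}" using both by blast
        then have "(C, i) = (D, j)" using g3 both by blast
        moreover have "inj_on (g C i) (verts T)" using gE both by (auto simp: embeddings_def)
        ultimately show ?thesis using e vB[OF xi] vB[OF yj] by (auto dest: inj_onD)
      next
        case left
        then have "g C i x = \<phi> y" using eq h1 h2 by simp
        then show ?thesis using g(2) left vB[OF yj] by blast
      next
        case right
        then have "g D j y = \<phi> x" using eq h1 h2 by simp
        then show ?thesis using g(2) right vB[OF xi] by blast
      next
        case none
        moreover have "inj_on \<phi> (verts T)" using \<phi> by (simp add: embeddings_def)
        ultimately show ?thesis using eq h2 vB[OF xi] vB[OF yj] by (auto dest: inj_onD)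
      qed
    qed
    show "h ` verts (blowup T (\<Union>P) t) \<subseteq> verts G"
    proof clarify
      fix x i assume xi: "(x, i) \<in> verts (blowup T (\<Union>P) t)"
      show "h (x, i) \<in> verts G"
        using vB[OF xi] h1 h2 gE \<phi> by (auto simp: embeddings_def PiE_iff)
    qed
    show "h ` e \<in> edges G" if "e \<in> edges (blowup T (\<Union>P) t)" for e
    proof -
      obtain x i y j where e: "e = {(x, i), (y, j)}" and xi: "(x, i) \<in> verts (blowup T (\<Union>P) t)"
        and yj: "(y, j) \<in> verts (blowup T (\<Union>P) t)" and xy: "{x, y} \<in> edges T"
        and ij: "x \<in> \<Union>P \<longrightarrow> y \<in> \<Union>P \<longrightarrow> i = j"
        using \<open>e \<in> edges (blowup T (\<Union>P) t)\<close> unfolding edges_blowup by blast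
      have pres: "{\<psi> x, \<psi> y} \<in> edges G" if "\<psi> \<in> embeddings T G" for \<psi>
        using that xy unfolding embeddings_def by fastforce
      consider (both) C D where "C \<in> P" "x \<in> C" "i < t" "D \<in> P" "y \<in> D" "j < t"
        | (left) C where "C \<in> P" "x \<in> C" "i < t" "y \<notin> \<Union>P"
        | (right) D where "D \<in> P" "y \<in> D" "j < t" "x \<notin> \<Union>P"
        | (none) "x \<notin> \<Union>P" "y \<notin> \<Union>P" using vB[OF xi] vB[OF yj]
        by (elim conjE disjE bexE) (rule that; assumption)+
      then have "{h (x, i), h (y, j)} \<in> edges G"
      proof cases
        case both
        then have "\<not> separated T C D" using xy by (auto simp: separated_def)
        then have "C = D" using pairwiseD[OF P(1)] both by blast
        moreover have "i = j" using ij both by blast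
        ultimately show ?thesis using both h1[of C] pres[OF gE[of C i]] by simp
      next
        case left
        \<comment> \<open>\<open>y\<close> is a neighbour of \<open>C\<close> outside
          \<open>C\<close>, where the re-embedding agrees with \<open>\<phi>\<close>; so
          \<open>g C i\<close> alone carries both ends of the edge.\<close>
        then have "g C i y = \<phi> y"
          using boundary[OF left(1) g(1)[OF left(1,3)], of y x] vB[OF yj] xy by (auto simp: insert_commute)
        then show ?thesis using left h1[of C] h2 pres[OF gE[of C i]] by simp
      next
        case right
        then have "g D j x = \<phi> x"
          using boundary[OF right(1) g(1)[OF right(1,3)], of x y] vB[OF xi] xy by auto
        then show ?thesis using right h1[of D] h2 pres[OF gE[of D j]] by simp
      next
        case none then show ?thesis using h2 pres[OF \<phi>] by simp
      qed
      then show ?thesis using e by simp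
    qed
  qed
  then show ?thesis by blast
qed

text \<open>The members of \<open>\<Psi>\<close> embed the whole of \<open>T\<close>, but away from
  \<open>C\<close> and its neighbours they may differ from \<open>\<phi>\<close> freely: gluing uses
  only their values on \<open>C\<close> and its boundary.\<close>

definition flexible :: "'a graph \<Rightarrow> 'b graph \<Rightarrow> nat \<Rightarrow> ('a \<Rightarrow> 'b) \<Rightarrow> 'a set \<Rightarrow> bool" where
  "flexible T G r \<phi> C \<longleftrightarrow> C \<subseteq> verts T \<and> connected_set T C \<and>
     (\<exists>\<Psi> \<subseteq> embeddings T G. card \<Psi> = r \<and>
        (\<forall>\<psi>\<in>\<Psi>. \<forall>x\<in>verts T - C. \<forall>y\<in>C. {x, y} \<in> edges T \<longrightarrow> \<psi> x = \<phi> x) \<and>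
        (\<forall>\<psi>\<in>\<Psi>. \<forall>\<psi>'\<in>\<Psi>. \<psi> \<noteq> \<psi>' \<longrightarrow> \<psi> ` C \<inter> \<psi>' ` C = {}))"

lemma flexibleD: "flexible T G r \<phi> C \<Longrightarrow> C \<subseteq> verts T" "flexible T G r \<phi> C \<Longrightarrow> connected_set T C"
  unfolding flexible_def by (elim conjE, assumption)+

text \<open>\<open>C\<close> is a component of the complement of \<open>K\<close>: its outside
  neighbours lie in \<open>K\<close>, where the whole sunflower agrees with \<open>\<phi>\<close>,
  and its images lie in the disjoint petals.\<close>

lemma sunflower_imp_flexible:
  assumes T: "simple_graph T" and K: "K \<subset> verts T"
    and \<Psi>: "\<Psi> \<subseteq> embeddings T G" "sunflower (verts T) K \<Psi>" "\<phi> \<in> \<Psi>"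
  shows "\<exists>C. flexible T G (card \<Psi>) \<phi> C \<and> C \<inter> K = {}"
proof -
  have "finite (verts T - K)" "verts T - K \<noteq> {}" using T K by (auto simp: simple_graph_def)
  from connected_component_exists[OF this, of T] obtain C where
    C: "C \<subseteq> verts T - K" "connected_set T C" "separated T C (verts T - K - C)" by (elim exE conjE)
  have "\<psi> x = \<phi> x" if "\<psi> \<in> \<Psi>" "x \<in> verts T - C" "y \<in> C" "{x, y} \<in> edges T" for \<psi> x y
  proof -
    have "{y, x} \<in> edges T" using that by (simp add: insert_commute)
    then have "x \<notin> verts T - K - C" using C(3) that(3) by (auto simp: separated_def)
    then have "x \<in> K" using that(2) by blast
    then show ?thesis using \<Psi>(2,3) that(1) by (simp add: sunflower_def)
  qed
  moreover have "\<psi> ` C \<inter> \<psi>' ` C = {}" if "\<psi> \<in> \<Psi>" "\<psi>' \<in> \<Psi>" "\<psi> \<noteq> \<psi>'" for \<psi> \<psi>'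
  proof -
    have "\<psi> ` (verts T - K) \<inter> \<psi>' ` (verts T - K) = {}" using \<Psi>(2) that by (simp add: sunflower_def)
    then show ?thesis using C(1) by blast
  qed
  ultimately have "flexible T G (card \<Psi>) \<phi> C"
    unfolding flexible_def using C(1,2) \<Psi>(1) by (intro conjI exI[of _ \<Psi>] ballI impI) auto
  then show ?thesis using C(1) by blast
qed

section \<open>Counting embeddings by their values on few edges\<close>

lemma card_ordered_edges_le:
  assumes G: "simple_graph G"
  shows "finite {(u, v). {u, v} \<in> edges G}" "card {(u, v). {u, v} \<in> edges G} \<le> 2 * card (edges G)"
proof -
  define D where "D = {(u, v). {u, v} \<in> edges G}"
  define f where "f p = {fst p, snd p}" for p :: "'a \<times> 'a"
  have D: "p \<in> D \<longleftrightarrow> f p \<in> edges G" for p by (simp add: D_def f_def case_prod_beta)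
  have fin: "finite D"
  proof (rule finite_subset)
    show "D \<subseteq> verts G \<times> verts G"
    proof
      fix p assume "p \<in> D"
      then have "{fst p, snd p} \<in> edges G" by (simp add: D f_def)
      from simple_edge_distinct[OF G this] show "p \<in> verts G \<times> verts G" by (simp add: mem_Times_iff)
    qed
  qed (simp add: simple_graphD(1)[OF G])
  have "card {p \<in> D. f p = e} \<le> 2" if "e \<in> f ` D" for e
  proof -
    obtain q where q: "e = f q" using \<open>e \<in> f ` D\<close> by (rule imageE)
    have "{p \<in> D. f p = e} \<subseteq> {(fst q, snd q), (snd q, fst q)}"
    proof
      fix p assume "p \<in> {p \<in> D. f p = e}"
      then have "{fst p, snd p} = {fst q, snd q}" by (simp add: q f_def)
      then show "p \<in> {(fst q, snd q), (snd q, fst q)}" by (simp add: doubleton_eq_iff prod_eq_iff)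
    qed
    then have "card {p \<in> D. f p = e} \<le> card {(fst q, snd q), (snd q, fst q)}" by (rule card_mono[rotated]) simp
    also have "\<dots> \<le> 2" by (simp add: card_insert_if)
    finally show ?thesis .
  qed
  then have "card D \<le> 2 * card (f ` D)" by (rule card_le_fibers[OF fin])
  moreover have "f ` D \<subseteq> edges G" using D by blast
  then have "card (f ` D) \<le> card (edges G)" by (rule card_mono[OF finite_edges[OF G]])
  ultimately have "card D \<le> 2 * card (edges G)" by simp
  then show "finite {(u, v). {u, v} \<in> edges G}" "card {(u, v). {u, v} \<in> edges G} \<le> 2 * card (edges G)"
    using fin unfolding D_def by blast+
qed

text \<open>A restriction to \<open>\<Union>B\<close> is determined by its restrictions to the
  single edges in \<open>B\<close>, and each of these amounts to an oriented edge of
  \<open>G\<close>.\<close>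

lemma card_edge_restrictions_le:
  fixes T :: "'a graph" and G :: "'b graph"
  assumes T: "simple_graph T" and G: "simple_graph G" and B: "B \<subseteq> edges T"
  shows "card ((\<lambda>\<phi>. restrict \<phi> (\<Union>B)) ` embeddings T G) \<le> (2 * card (edges G)) ^ card B"
proof -
  let ?E = "embeddings T G"
  have finE: "finite ?E" by (rule finite_embeddings[OF T G])
  have finB: "finite B" using B finite_edges[OF T] by (rule finite_subset)
  define \<rho> where "\<rho> b = (\<lambda>\<phi> :: 'a \<Rightarrow> 'b. restrict \<phi> b) ` ?E" for b
  have one: "card (\<rho> b) \<le> 2 * card (edges G)" if "b \<in> B" for b
  proof -
    have b: "b \<in> edges T" using B that by auto
    then obtain x y where xy: "b = {x, y}" "x \<noteq> y"
      using simple_graphD(3)[OF T b] by (auto simp: card_2_iff)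
    have "\<rho> b \<subseteq> (\<lambda>(u, v). \<lambda>z\<in>b. if z = x then u else v) ` {(u, v). {u, v} \<in> edges G}"
    proof
      fix r assume "r \<in> \<rho> b"
      then obtain \<phi> where \<phi>: "\<phi> \<in> ?E" "r = restrict \<phi> b" by (auto simp: \<rho>_def)
      then have "\<phi> ` b \<in> edges G" using b by (simp add: embeddings_def)
      then have "(\<phi> x, \<phi> y) \<in> {(u, v). {u, v} \<in> edges G}" by (simp add: xy)
      moreover have "r = (\<lambda>z\<in>b. if z = x then \<phi> x else \<phi> y)" using \<phi> xy by (auto simp: fun_eq_iff)
      ultimately show "r \<in> (\<lambda>(u, v). \<lambda>z\<in>b. if z = x then u else v) ` {(u, v). {u, v} \<in> edges G}"
        by (intro image_eqI[of _ _ "(\<phi> x, \<phi> y)"]) auto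
    qed
    then have "card (\<rho> b) \<le> card {(u, v). {u, v} \<in> edges G}"
      using card_ordered_edges_le(1)[OF G] by (rule surj_card_le[rotated])
    then show ?thesis using card_ordered_edges_le(2)[OF G] by simp
  qed
  let ?R = "(\<lambda>\<phi>. restrict \<phi> (\<Union>B)) ` ?E"
  have "inj_on (\<lambda>r. \<lambda>b\<in>B. restrict r b) ?R"
  proof (rule inj_onI)
    fix r r' assume r: "r \<in> ?R" "r' \<in> ?R" and eq: "(\<lambda>b\<in>B. restrict r b) = (\<lambda>b\<in>B. restrict r' b)"
    have "r x = r' x" if x: "x \<in> \<Union>B" for x
    proof -
      obtain b where b: "b \<in> B" "x \<in> b" using x by blast
      then have "restrict r b = restrict r' b" using fun_cong[OF eq, of b] by simp
      then have "restrict r b x = restrict r' b x" by (rule fun_cong)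
      then show ?thesis using b by simp
    qed
    moreover have "r \<in> extensional (\<Union>B)" "r' \<in> extensional (\<Union>B)"
      using r by (elim imageE; simp)+
    ultimately show "r = r'" by (intro extensionalityI)
  qed
  moreover have "(\<lambda>r. \<lambda>b\<in>B. restrict r b) ` ?R \<subseteq> PiE B \<rho>"
  proof (rule image_subsetI)
    fix r assume "r \<in> ?R"
    then obtain \<phi> where \<phi>: "\<phi> \<in> ?E" "r = restrict \<phi> (\<Union>B)" by blast
    have "restrict r b = restrict \<phi> b" if "b \<in> B" for b
    proof
      fix x
      show "restrict r b x = restrict \<phi> b x" using that by (cases "x \<in> b") (auto simp: \<phi>(2))
    qed
    then show "(\<lambda>b\<in>B. restrict r b) \<in> PiE B \<rho>"
      using \<phi>(1) unfolding \<rho>_def by (intro restrict_PiE_iff[THEN iffD2] ballI) simp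
  qed
  moreover have "finite (PiE B \<rho>)" using finB finE by (intro finite_PiE) (auto simp: \<rho>_def)
  ultimately have "card ?R \<le> card (PiE B \<rho>)" by (rule card_inj_on_le)
  also have "\<dots> = (\<Prod>b\<in>B. card (\<rho> b))" using finB by (rule card_PiE)
  also have "\<dots> \<le> (\<Prod>b\<in>B. 2 * card (edges G))" using one by (intro prod_mono) auto
  finally show ?thesis by simp
qed

text \<open>Here \<open>T\<close> being different from \<open>K_1\<close> enters: a path from
  \<open>v\<close> to a second vertex starts with an edge at \<open>v\<close>. Hitting sets can
  therefore be taken to consist of edges.\<close>

lemma tree_vertex_in_edge:
  assumes T: "tree T" and nontriv: "\<not> graph_iso T (complete_graph 1)" and v: "v \<in> verts T"
  shows "\<exists>e\<in>edges T. v \<in> e"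
proof -
  have simple: "simple_graph T" and conn: "connected_graph T" using T by (simp_all add: tree_def)
  have "verts T \<noteq> {v}"
  proof
    assume V: "verts T = {v}"
    have "edges T = {}"
    proof (rule ccontr)
      assume "edges T \<noteq> {}"
      then obtain e where "e \<in> edges T" by blast
      then have "e \<subseteq> {v}" "card e = 2" using simple V by (auto simp: simple_graph_def)
      then show False using card_mono[of "{v}" e] by simp
    qed
    moreover have "card e \<noteq> 2" if "e \<subseteq> {..<1}" for e :: "nat set"
      using card_mono[OF _ that] by simp
    then have "{e. e \<subseteq> {..<1} \<and> card e = 2} = ({} :: nat set set)" by blast
    ultimately have "graph_iso T (complete_graph 1)"
      unfolding graph_iso_def complete_graph_def using V
      by (intro exI[of _ "\<lambda>_. 0"]) (auto simp: bij_betw_def)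
    then show False using nontriv by blast
  qed
  then obtain w where "w \<in> verts T" "w \<noteq> v" using v by blast
  then have "(v, w) \<in> {(x, y). {x, y} \<in> edges T}\<^sup>*" "v \<noteq> w"
    using conn v by (auto simp: connected_graph_def)
  then obtain y where "{v, y} \<in> edges T" by (auto elim: converse_rtranclE)
  then show ?thesis by blast
qed

text \<open>If \<open>k\<close> pairwise separated sets were flexible, \<open>blowup_embeds\<close>
  would produce an excluded blow-up; the bound on \<open>r\<close> is its size condition for
  \<open>k\<close> parts. Hence \<open>subtree_duality\<close> yields fewer than \<open>k\<close>
  edges and vertices meeting all flexible sets.\<close>

lemma flexible_hitting_edges:
  fixes T :: "'a graph" and G :: "'b graph"
  assumes T: "tree T" "\<not> graph_iso T (complete_graph 1)"
    and no: "\<And>P. card P = k \<Longrightarrow> pairwise (separated T) P \<Longrightarrow>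
      (\<And>C. C \<in> P \<Longrightarrow> C \<noteq> {} \<and> C \<subseteq> verts T) \<Longrightarrow> embeddings (blowup T (\<Union>P) t) G = {}"
    and r: "card (verts T) * Suc (k * t) < r"
    and \<phi>: "\<phi> \<in> embeddings T G"
  shows "\<exists>B \<subseteq> edges T. card B < k \<and> (\<forall>C. flexible T G r \<phi> C \<longrightarrow> C \<inter> \<Union>B \<noteq> {})"
proof -
  have simple: "simple_graph T" and acyc: "\<nexists>vs. is_cycle T vs"
    using T(1) by (simp_all add: tree_def)
  have finV: "finite (verts T)" using simple by (simp add: simple_graph_def)
  have "card P < k" if P: "P \<subseteq> {C. flexible T G r \<phi> C}" "pairwise (separated T) P" for P
  proof (rule ccontr)
    assume "\<not> card P < k"
    then have "k \<le> card P" by simp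
    \<comment> \<open>The assumption on blow-ups speaks of exactly \<open>k\<close> parts, so a
      larger family is cut down.\<close>
    then obtain Q where Q: "Q \<subseteq> P" "card Q = k" by (rule obtain_subset_with_card_n)
    have flex: "flexible T G r \<phi> C" if "C \<in> Q" for C using subsetD[OF P(1) subsetD[OF Q(1) that]] by simp
    have sepQ: "pairwise (separated T) Q" using P(2) Q(1) by (rule pairwise_subset)
    have "\<forall>C\<in>Q. \<exists>\<Psi>. \<Psi> \<subseteq> embeddings T G \<and> card \<Psi> = r \<and>
        (\<forall>\<psi>\<in>\<Psi>. \<forall>x\<in>verts T - C. \<forall>y\<in>C. {x, y} \<in> edges T \<longrightarrow> \<psi> x = \<phi> x) \<and>
        (\<forall>\<psi>\<in>\<Psi>. \<forall>\<psi>'\<in>\<Psi>. \<psi> \<noteq> \<psi>' \<longrightarrow> \<psi> ` C \<inter> \<psi>' ` C = {})"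
    proof (rule ballI)
      fix C assume "C \<in> Q"
      from flex[OF this] show "\<exists>\<Psi>. \<Psi> \<subseteq> embeddings T G \<and> card \<Psi> = r \<and>
        (\<forall>\<psi>\<in>\<Psi>. \<forall>x\<in>verts T - C. \<forall>y\<in>C. {x, y} \<in> edges T \<longrightarrow> \<psi> x = \<phi> x) \<and>
        (\<forall>\<psi>\<in>\<Psi>. \<forall>\<psi>'\<in>\<Psi>. \<psi> \<noteq> \<psi>' \<longrightarrow> \<psi> ` C \<inter> \<psi>' ` C = {})"
        unfolding flexible_def by (elim conjE)
    qed
    from bchoice[OF this] obtain \<Psi> where "\<forall>C\<in>Q. \<Psi> C \<subseteq> embeddings T G \<and> card (\<Psi> C) = r \<and>
        (\<forall>\<psi>\<in>\<Psi> C. \<forall>x\<in>verts T - C. \<forall>y\<in>C. {x, y} \<in> edges T \<longrightarrow> \<psi> x = \<phi> x) \<and>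
        (\<forall>\<psi>\<in>\<Psi> C. \<forall>\<psi>'\<in>\<Psi> C. \<psi> \<noteq> \<psi>' \<longrightarrow> \<psi> ` C \<inter> \<psi>' ` C = {})" ..
    note \<Psi> = this[THEN bspec]
    have sub: "C \<noteq> {} \<and> C \<subseteq> verts T" if "C \<in> Q" for C
      using flexibleD[OF flex[OF that]] by (simp add: connected_set_def)
    have "embeddings (blowup T (\<Union>Q) t) G \<noteq> {}"
    proof (rule blowup_embeds[OF simple sepQ _ \<phi>, of \<Psi>])
      show "card (verts T) * Suc (card Q * t) < card (\<Psi> C)" if "C \<in> Q" for C
        using \<Psi>[OF that] r Q(2) by simp
      show "C \<subseteq> verts T" if "C \<in> Q" for C using sub[OF that] by simp
      show "\<Psi> C \<subseteq> embeddings T G" if "C \<in> Q" for C using \<Psi>[OF that] by simp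
      show "\<psi> x = \<phi> x" if "C \<in> Q" "\<psi> \<in> \<Psi> C" "x \<in> verts T - C" "y \<in> C" "{x, y} \<in> edges T"
        for C \<psi> x y using \<Psi>[OF that(1)] that(2-) by blast
      show "\<psi> ` C \<inter> \<psi>' ` C = {}" if "C \<in> Q" "\<psi> \<in> \<Psi> C" "\<psi>' \<in> \<Psi> C" "\<psi> \<noteq> \<psi>'"
        for C \<psi> \<psi>' using \<Psi>[OF that(1)] that(2-) by blast
    qed
    moreover have "embeddings (blowup T (\<Union>Q) t) G = {}" by (rule no[OF Q(2) sepQ sub])
    ultimately show False by simp
  qed
  moreover have "\<exists>l\<in>X. \<exists>p. \<forall>q\<in>X. {l, q} \<in> edges T \<longrightarrow> q = p" if "X \<subseteq> verts T" "X \<noteq> {}" for X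
    using acyclic_imp_leaf[OF simple acyc finite_subset[OF that(1) finV] that(2)] .
  moreover have "D \<subseteq> verts T \<and> connected_set T D" if "D \<in> {C. flexible T G r \<phi> C}" for D
    using that flexibleD[of T G r \<phi> D] by simp
  ultimately have "\<exists>B. B \<subseteq> edges T \<union> (\<lambda>v. {v}) ` verts T \<and> finite B \<and> card B < k \<and>
      (\<forall>C\<in>{C. flexible T G r \<phi> C}. \<exists>b\<in>B. b \<inter> C \<noteq> {})"
    by (intro subtree_duality[OF finV])
  then obtain B where B: "B \<subseteq> edges T \<union> (\<lambda>v. {v}) ` verts T" "finite B" "card B < k"
      "\<forall>C\<in>{C. flexible T G r \<phi> C}. \<exists>b\<in>B. b \<inter> C \<noteq> {}"
    by (elim exE conjE)
  \<comment> \<open>Singletons in \<open>B\<close> are enlarged to edges, so that images of the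
    hitting set can be counted by edges of \<open>G\<close>.\<close>
  have "\<forall>b\<in>B. \<exists>e\<in>edges T. b \<subseteq> e"
  proof
    fix b assume "b \<in> B"
    then consider "b \<in> edges T" | v where "v \<in> verts T" "b = {v}" using B(1) by blast
    then show "\<exists>e\<in>edges T. b \<subseteq> e"
      by cases (use tree_vertex_in_edge[OF T] in auto)
  qed
  then obtain e where e: "\<And>b. b \<in> B \<Longrightarrow> e b \<in> edges T \<and> b \<subseteq> e b" by metis
  have "card (e ` B) < k" using card_image_le[OF B(2), of e] B(3) by simp
  moreover have "C \<inter> \<Union>(e ` B) \<noteq> {}" if fl: "flexible T G r \<phi> C" for C
  proof -
    obtain b x where "b \<in> B" "x \<in> b" "x \<in> C" using B(4) fl by blast
    then show ?thesis using e by blast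
  qed
  ultimately show ?thesis using e by (intro exI[of _ "e ` B"]) auto
qed

text \<open>Embeddings are grouped by a hitting set of fewer than \<open>k\<close> edges and their
  values on it. The number of groups is \<open>O(e(G)^(k-1))\<close>, and sunflowers bound the size
  of each. \<open>M\<close> is fixed before \<open>G\<close>.\<close>

lemma card_embeddings_le:
  fixes T :: "'a graph"
  assumes T: "tree T" "\<not> graph_iso T (complete_graph 1)"
  shows "\<exists>M. \<forall>G :: 'b graph. simple_graph G \<longrightarrow>
    (\<forall>P. card P = k \<longrightarrow> pairwise (separated T) P \<longrightarrow> (\<forall>C\<in>P. C \<noteq> {} \<and> C \<subseteq> verts T) \<longrightarrow>
      embeddings (blowup T (\<Union>P) t) G = {}) \<longrightarrow>
    card (embeddings T G) \<le> M * card (edges G) ^ (k - 1)"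
proof -
  have simple: "simple_graph T" using T by (simp add: tree_def)
  have finV: "finite (verts T)" using simple by (simp add: simple_graph_def)
  \<comment> \<open>The least number allowed by the size condition for gluing \<open>t\<close>
    clones of each of \<open>k\<close> parts.\<close>
  define r where "r = Suc (card (verts T) * Suc (k * t))"
  define bound where "bound d N \<longleftrightarrow> (\<forall>A (\<Phi> :: ('a \<Rightarrow> 'b) set). A \<subseteq> verts T \<longrightarrow> card (verts T - A) = d \<longrightarrow>
    finite \<Phi> \<longrightarrow> N < card \<Phi> \<longrightarrow> \<Phi> \<subseteq> extensional (verts T) \<longrightarrow> (\<forall>\<phi>\<in>\<Phi>. \<forall>\<psi>\<in>\<Phi>. \<forall>x\<in>A. \<phi> x = \<psi> x) \<longrightarrow>
    (\<exists>K \<Psi>. A \<subseteq> K \<and> K \<subset> verts T \<and> \<Psi> \<subseteq> \<Phi> \<and> card \<Psi> = r \<and> sunflower (verts T) K \<Psi>))" for d N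
  have "\<exists>N. bound d N" for d unfolding bound_def by (rule sunflower_functions[OF finV])
  then obtain N where N: "\<And>d. bound d (N d)" by metis
  \<comment> \<open>A single bound for every possible number of vertices left uncovered by the
    hitting set.\<close>
  define N' where "N' = (\<Sum>d\<le>card (verts T). N d)"
  define M where "M = N' * (2 ^ card (edges T) * 2 ^ (k - 1))"
  have "card (embeddings T G) \<le> M * card (edges G) ^ (k - 1)" if G: "simple_graph G"
    and no: "\<forall>P. card P = k \<longrightarrow> pairwise (separated T) P \<longrightarrow> (\<forall>C\<in>P. C \<noteq> {} \<and> C \<subseteq> verts T) \<longrightarrow>
      embeddings (blowup T (\<Union>P) t) G = {}" for G :: "'b graph"
  \<comment> \<open>With \<open>e(G) = 0\<close>, raising exponents to \<open>k - 1\<close> could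
    decrease a power, but then there are no embeddings, since \<open>T\<close> has an edge.\<close>
  proof (cases "edges G = {}")
    case True
    obtain v where "v \<in> verts T" using T by (auto simp: tree_def connected_graph_def)
    then have "edges T \<noteq> {}" using tree_vertex_in_edge[OF T] by blast
    then have "embeddings T G = {}" using True by (auto simp: embeddings_def)
    then show ?thesis by simp
  next
    case False
    let ?E = "embeddings T G" and ?m = "2 * card (edges G)"
    have m: "1 \<le> ?m" using False finite_edges[OF G] by (simp add: card_gt_0_iff Suc_le_eq)
    have finE: "finite ?E" by (rule finite_embeddings[OF simple G])
    have "\<exists>B \<subseteq> edges T. card B < k \<and> (\<forall>C. flexible T G r \<phi> C \<longrightarrow> C \<inter> \<Union>B \<noteq> {})" if "\<phi> \<in> ?E" for \<phi>
      using no by (intro flexible_hitting_edges[OF T _ _ that, of k t]) (auto simp: r_def)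
    then obtain \<beta> where \<beta>: "\<And>\<phi>. \<phi> \<in> ?E \<Longrightarrow> \<beta> \<phi> \<subseteq> edges T \<and> card (\<beta> \<phi>) < k \<and>
        (\<forall>C. flexible T G r \<phi> C \<longrightarrow> C \<inter> \<Union>(\<beta> \<phi>) \<noteq> {})" by metis
    define F where "F \<phi> = (\<beta> \<phi>, restrict \<phi> (\<Union>(\<beta> \<phi>)))" for \<phi>
    \<comment> \<open>A larger fiber contains a sunflower whose kernel includes the vertices
      \<open>A\<close> of the common hitting set. One of its members then has a flexible set
      disjoint from \<open>A\<close>, against the choice of \<open>\<beta>\<close>.\<close>
    have fiber: "card {\<phi> \<in> ?E. F \<phi> = y} \<le> N'" if y: "y \<in> F ` ?E" for y
    proof (rule ccontr)
      define \<Phi> where "\<Phi> = {\<phi> \<in> ?E. F \<phi> = y}"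
      define A where "A = \<Union>(fst y)"
      assume "\<not> ?thesis"
      then have large: "N' < card \<Phi>" by (simp add: \<Phi>_def)
      have AV: "A \<subseteq> verts T"
      proof -
        obtain \<phi> where "\<phi> \<in> ?E" "A = \<Union>(\<beta> \<phi>)" using y by (auto simp: A_def F_def)
        then show ?thesis using \<beta> simple_graphD(2)[OF simple] by blast
      qed
      then have "card (verts T - A) \<le> card (verts T)" using finV by (intro card_mono) auto
      then have "N (card (verts T - A)) \<le> N'" unfolding N'_def by (intro member_le_sum) auto
      then have "N (card (verts T - A)) < card \<Phi>" using large by simp
      moreover have "\<forall>\<phi>\<in>\<Phi>. \<forall>\<psi>\<in>\<Phi>. \<forall>x\<in>A. \<phi> x = \<psi> x"
      proof (intro ballI)
        fix \<phi> \<psi> x assume "\<phi> \<in> \<Phi>" "\<psi> \<in> \<Phi>" "x \<in> A"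
        moreover from this have "restrict \<phi> A = restrict \<psi> A" by (auto simp: \<Phi>_def F_def A_def)
        ultimately show "\<phi> x = \<psi> x" by (metis restrict_apply')
      qed
      moreover have "\<Phi> \<subseteq> extensional (verts T)" by (auto simp: \<Phi>_def embeddings_def PiE_def)
      moreover have "finite \<Phi>" using finE by (simp add: \<Phi>_def)
      ultimately have "\<exists>K \<Psi>. A \<subseteq> K \<and> K \<subset> verts T \<and> \<Psi> \<subseteq> \<Phi> \<and> card \<Psi> = r \<and> sunflower (verts T) K \<Psi>"
        using N[of "card (verts T - A)", unfolded bound_def, rule_format, of A \<Phi>] AV by simp
      then obtain K \<Psi> where K: "A \<subseteq> K" "K \<subset> verts T" "\<Psi> \<subseteq> \<Phi>" "card \<Psi> = r"
          "sunflower (verts T) K \<Psi>"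
        by (elim exE conjE)
      have "\<Psi> \<noteq> {}" using K(4) by (auto simp: r_def)
      then obtain \<phi> where \<phi>: "\<phi> \<in> \<Psi>" by blast
      have "\<Psi> \<subseteq> ?E" using K(3) by (auto simp: \<Phi>_def)
      then obtain C where C: "flexible T G r \<phi> C" "C \<inter> K = {}"
        using sunflower_imp_flexible[OF simple K(2) _ K(5) \<phi>, of G] K(4) by blast
      have "\<phi> \<in> ?E" "\<beta> \<phi> = fst y" using \<phi> K(3) by (auto simp: \<Phi>_def F_def)
      then have "C \<inter> A \<noteq> {}" using \<beta>[of \<phi>] C(1) by (simp add: A_def)
      then show False using C(2) K(1) by blast
    qed
    define \<B> where "\<B> = {B. B \<subseteq> edges T \<and> card B < k}"
    have fin\<B>: "finite \<B>" unfolding \<B>_def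
      by (rule finite_subset[of _ "Pow (edges T)"]) (auto simp: finite_edges[OF simple])
    have c\<B>: "card \<B> \<le> 2 ^ card (edges T)"
      using card_mono[of "Pow (edges T)" \<B>] finite_edges[OF simple] by (auto simp: \<B>_def card_Pow)
    let ?R = "\<lambda>B. (\<lambda>\<phi>. restrict \<phi> (\<Union>B)) ` ?E"
    have R: "card (?R B) \<le> ?m ^ (k - 1)" if "B \<in> \<B>" for B
    proof -
      have "card (?R B) \<le> ?m ^ card B"
        using that by (intro card_edge_restrictions_le[OF simple G]) (auto simp: \<B>_def)
      also have "\<dots> \<le> ?m ^ (k - 1)" using that m by (intro power_increasing) (auto simp: \<B>_def)
      finally show ?thesis .
    qed
    have "card (F ` ?E) \<le> card (SIGMA B:\<B>. ?R B)"
    proof (intro card_mono finite_SigmaI image_subsetI)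
      show "F \<phi> \<in> (SIGMA B:\<B>. ?R B)" if "\<phi> \<in> ?E" for \<phi>
        using \<beta>[OF that] that by (simp add: F_def \<B>_def)
    qed (use fin\<B> finE in auto)
    also have "\<dots> = (\<Sum>B\<in>\<B>. card (?R B))" using fin\<B> finE by (intro card_SigmaI) auto
    also have "\<dots> \<le> card \<B> * ?m ^ (k - 1)" using sum_bounded_above[OF R] by simp
    also have "\<dots> \<le> 2 ^ card (edges T) * ?m ^ (k - 1)" using c\<B> by simp
    finally have "N' * card (F ` ?E) \<le> N' * (2 ^ card (edges T) * ?m ^ (k - 1))" by (rule mult_le_mono2)
    also have "\<dots> = M * card (edges G) ^ (k - 1)" by (simp add: M_def power_mult_distrib mult.assoc)
    finally show ?thesis using card_le_fibers[OF finE fiber] by linarith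
  qed
  then show ?thesis by blast
qed

section \<open>The two asymptotic bounds and the dichotomy\<close>

text \<open>Blow-ups with \<open>t = n div card (verts T)\<close> are used; as this quotient is at
  least 1, rounding loses at most a factor 2.\<close>

lemma gen_ex_lower_bound:
  fixes T :: "'a graph" and \<F> :: "'c graph set"
  assumes T: "simple_graph T" and simple: "\<And>H. H \<in> \<F> \<Longrightarrow> simple_graph H"
    and P: "pairwise (separated T) P" "\<And>C. C \<in> P \<Longrightarrow> C \<noteq> {} \<and> C \<subseteq> verts T" "P \<noteq> {}"
    and free: "\<And>t. free_of \<F> (blowup T (\<Union>P) t)"
    and n: "card (verts T) \<le> n"
  shows "(1 / (2 * card (verts T))) ^ card P * real n ^ card P \<le> real (gen_ex n T \<F>)"
proof -
  define s where "s = card (verts T)"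
  have "0 < s" using P(2,3) T by (fastforce simp: s_def card_gt_0_iff simple_graph_def)
  note n = n[folded s_def] and s = this
  have pos: "0 < n div s" using n s by (simp add: div_greater_zero_iff)
  have "(n div s) ^ card P \<le> gen_ex n T \<F>"
    by (rule gen_ex_ge_of_free_blowups[OF T simple P free]) (use pos in \<open>simp_all add: s_def\<close>)
  moreover have "n \<le> 2 * s * (n div s)"
  proof -
    have "n < s * (n div s) + s"
      using s by (metis add_less_cancel_left mod_less_divisor mult_div_mod_eq)
    moreover have "s \<le> s * (n div s)" using pos by simp
    ultimately show ?thesis by linarith
  qed
  then have "real n \<le> 2 * real s * real (n div s)" by (metis of_nat_le_iff of_nat_mult of_nat_numeral)
  then have "1 / (2 * s) * real n \<le> real (n div s)" using s by (simp add: field_simps)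
  then have "(1 / (2 * s) * real n) ^ card P \<le> real (n div s) ^ card P" by (intro power_mono) auto
  ultimately show ?thesis
    unfolding s_def[symmetric] by (metis (no_types) of_nat_le_iff of_nat_power order_trans power_mult_distrib)
qed

text \<open>Each of the finitely many families of \<open>k\<close> separated sets has a
  \<open>t\<close> at which its blow-up contains a member of \<open>\<F>\<close>. By monotonicity
  one \<open>t\<close> serves them all, so \<open>\<F>\<close>-free graphs contain none of these
  blow-ups and \<open>card_embeddings_le\<close> applies.\<close>

lemma gen_ex_upper_bound:
  fixes T :: "'a graph" and \<F> :: "nat graph set"
  assumes T: "tree T" "\<not> graph_iso T (complete_graph 1)" and simple: "\<forall>H\<in>\<F>. simple_graph H"
    and notfree0: "\<And>P. card P = k \<Longrightarrow> pairwise (separated T) P \<Longrightarrow> \<forall>C\<in>P. C \<noteq> {} \<and> C \<subseteq> verts T \<Longrightarrow>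
      \<exists>t. \<not> free_of \<F> (blowup T (\<Union>P) t)"
  shows "(\<lambda>n. real (gen_ex n T \<F>)) \<in> O(\<lambda>n. real (ex n \<F>) ^ (k - 1))"
proof -
  have simpleT: "simple_graph T" using T(1) by (simp add: tree_def)
  have finV: "finite (verts T)" using simpleT by (simp add: simple_graph_def)
  define \<P> where "\<P> = {P. card P = k \<and> pairwise (separated T) P \<and> (\<forall>C\<in>P. C \<noteq> {} \<and> C \<subseteq> verts T)}"
  have "\<exists>t. \<not> free_of \<F> (blowup T (\<Union>P) t)" if "P \<in> \<P>" for P
    using notfree0[of P] that by (simp add: \<P>_def)
  then obtain \<tau> where \<tau>: "\<And>P. P \<in> \<P> \<Longrightarrow> \<not> free_of \<F> (blowup T (\<Union>P) (\<tau> P))" by metis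
  have "finite \<P>" by (rule finite_subset[of _ "Pow (Pow (verts T))"]) (use finV in \<open>auto simp: \<P>_def\<close>)
  then have \<tau>_le: "\<tau> P \<le> (\<Sum>P\<in>\<P>. \<tau> P)" if "P \<in> \<P>" for P using that by (intro member_le_sum) auto
  \<comment> \<open>The sum is a convenient common upper bound of all
    \<open>\<tau> P\<close>.\<close>
  define t where "t = (\<Sum>P\<in>\<P>. \<tau> P)"
  have notfree: "\<not> free_of \<F> (blowup T (\<Union>P) t)" if P: "P \<in> \<P>" for P
  proof
    assume "free_of \<F> (blowup T (\<Union>P) t)"
    moreover have "restrict (\<lambda>x. x) (verts (blowup T (\<Union>P) (\<tau> P))) \<in>
        embeddings (blowup T (\<Union>P) (\<tau> P)) (blowup T (\<Union>P) t)"
      using blowup_mono[OF \<tau>_le[OF P], of T "\<Union>P"]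
      by (intro restrict_embedding simple_blowup[OF simpleT]) (auto simp: t_def)
    ultimately show False using \<tau>[OF P] simple free_of_embedding by blast
  qed
  obtain M where M: "\<And>G :: nat graph. simple_graph G \<Longrightarrow>
      (\<forall>P. card P = k \<longrightarrow> pairwise (separated T) P \<longrightarrow> (\<forall>C\<in>P. C \<noteq> {} \<and> C \<subseteq> verts T) \<longrightarrow>
        embeddings (blowup T (\<Union>P) t) G = {}) \<Longrightarrow>
      card (embeddings T G) \<le> M * card (edges G) ^ (k - 1)"
    using card_embeddings_le[OF T, of k t, where 'b = nat] by blast
  have bound: "card (copies T G) \<le> M * ex n \<F> ^ (k - 1)" if G: "G \<in> free_graphs n \<F>" for n G
  proof -
    have simpleG: "simple_graph G" and free: "free_of \<F> G" using G by (auto simp: free_graphs_def)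
    have "embeddings (blowup T (\<Union>P) t) G = {}" if "P \<in> \<P>" for P
      using notfree[OF that] free_of_embedding[of \<F> G _ "blowup T (\<Union>P) t"] simple free by blast
    then have "card (embeddings T G) \<le> M * card (edges G) ^ (k - 1)"
      by (intro M simpleG) (simp add: \<P>_def)
    moreover have "card (copies T G) \<le> card (embeddings T G)"
      unfolding copies_eq_image_embeddings[OF simpleT]
      by (rule card_image_le[OF finite_embeddings[OF simpleT simpleG]])
    moreover have "card (edges G) \<le> ex n \<F>"
      using G finite_free_graphs[of n \<F>] by (auto simp: ex_def intro!: Max_ge)
    then have "M * card (edges G) ^ (k - 1) \<le> M * ex n \<F> ^ (k - 1)" by (simp add: power_mono)
    ultimately show ?thesis by linarith
  qed
  \<comment> \<open>If no \<open>\<F>\<close>-free graph on \<open>n\<close> vertices exists, the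
    left side is 0 by convention.\<close>
  have "gen_ex n T \<F> \<le> M * ex n \<F> ^ (k - 1)" for n
    using bound finite_free_graphs[of n \<F>] by (auto simp: gen_ex_def)
  then have "real (gen_ex n T \<F>) \<le> real M * real (ex n \<F>) ^ (k - 1)" for n
    by (metis of_nat_le_iff of_nat_mult of_nat_power)
  then show ?thesis by (intro bigoI[of _ "real M"]) simp
qed

theorem theorem2p5:
  fixes T :: "'a graph" and k :: nat
  assumes "tree T" and "\<not> graph_iso T (complete_graph 1)" and "k \<ge> 1"
  shows "\<exists>c>0. \<exists>n0::nat. \<forall>\<F> :: nat graph set. (\<forall>H\<in>\<F>. simple_graph H) \<longrightarrow>
           (\<forall>n\<ge>n0. real (gen_ex n T \<F>) \<ge> c * real n ^ k) \<or>
           (\<lambda>n. real (gen_ex n T \<F>)) \<in> O(\<lambda>n. real (ex n \<F>) ^ (k - 1))"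
proof -
  have T: "simple_graph T" using assms(1) by (simp add: tree_def)
  then have "0 < card (verts T)"
    using assms(1) by (simp add: simple_graph_def tree_def connected_graph_def card_gt_0_iff)
  \<comment> \<open>The constant and the threshold involve only \<open>T\<close> and
    \<open>k\<close>, so they can be fixed before \<open>\<F>\<close>.\<close>
  moreover have "(\<forall>n\<ge>card (verts T). (1 / (2 * card (verts T))) ^ k * real n ^ k \<le> real (gen_ex n T \<F>)) \<or>
      (\<lambda>n. real (gen_ex n T \<F>)) \<in> O(\<lambda>n. real (ex n \<F>) ^ (k - 1))"
    if simple: "\<forall>H\<in>\<F>. simple_graph H" for \<F> :: "nat graph set"
  proof (cases "\<exists>P. card P = k \<and> pairwise (separated T) P \<and> (\<forall>C\<in>P. C \<noteq> {} \<and> C \<subseteq> verts T) \<and>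
      (\<forall>t. free_of \<F> (blowup T (\<Union>P) t))")
    case True
    then obtain P where P: "card P = k" "pairwise (separated T) P" "\<forall>C\<in>P. C \<noteq> {} \<and> C \<subseteq> verts T"
      "\<forall>t. free_of \<F> (blowup T (\<Union>P) t)" by (elim exE conjE)
    \<comment> \<open>This uses \<open>k \<ge> 1\<close>; some part must exist to supply the
      \<open>n\<close> clones that make room for padding the host.\<close>
    moreover from this have "P \<noteq> {}" using assms(3) by auto
    ultimately show ?thesis using gen_ex_lower_bound[OF T, of \<F> P] simple by simp
  next
    case False
    then show ?thesis using gen_ex_upper_bound[OF assms(1,2) simple, of k] by metis
  qed
  ultimately show ?thesis
    by (intro exI[of _ "(1 / (2 * card (verts T))) ^ k"] conjI exI[of _ "card (verts T)"] allI impI) auto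
qed

end
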